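(* Let $G$ be a compactly generated locally compact abelian group and let $\mathcal{L}$ be a Delone set in $G$ with finite local complexity. Then the following assertions are equivalent: (i) $\mathcal{L}$ is completely periodic. (ii) The dynamical system $(X(\mathcal{L}),G)$ is equicontinuous.
   Context: Groups are Hausdorff and written additively, with neutral element $e$. A locally compact abelian group $G$ is compactly generated if there is a compact neighborhood $W$ of $e$ such that the smallest subgroup of $G$ containing $W$ is $G$. A subset $A\subset G$ is relatively dense if there is a compact $K\subset G$ with $A+K=G$. A subset $\mathcal{L}\subset G$ is uniformly discrete if there is an open neighborhood $U$ of $e$ with $(x+U)\cap(y+U)=\emptyset$ for all $x\neq y$ in $\mathcal{L}$; it is a Delone set if it is uniformly discrete and relatively dense. $\mathcal{L}$ has finite local complexity if for every compact $K\subset G$ the set $\{(-x+\mathcal{L})\cap K : x\in\mathcal{L}\}$ is finite. The periods of $\mathcal{L}$ are the $t\in G$ with $t+\mathcal{L}=\mathcal{L}$; $\mathcal{L}$ is completely periodic (crystalline) if its set of periods is relatively dense in $G$. Hull: a uniformly discrete set $M\subset G$ is identified with the measure $\delta_M=\sum_{x\in M}\delta_x$, where $\delta_x$ is the unit point mass at $x$. The hull $X(\mathcal{L})$ is the closure of $\{\delta_{t+\mathcal{L}}:t\in G\}$ in the vague topology, i.e. the weakest topology on measures making all maps $\mu\mapsto\int\varphi\,d\mu$, $\varphi\in C_c(G)$, continuous. It is compact Hausdorff, all its elements are of the form $\delta_M$ with $M$ uniformly discrete (and are identified with $M$), and $G$ acts continuously on it by $t\cdot M=t+M$. Equicontinuity: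 a dynamical system $(X,G)$ with $X$ compact Hausdorff and unique compatible uniform structure $\mathcal{U}$ is equicontinuous if for every $V\in\mathcal{U}$ there is $U\in\mathcal{U}$ such that $(x,y)\in U$ implies $(t\cdot x,t\cdot y)\in V$ for all $t\in G$. *)

theory Defs
  imports "HOL-Analysis.Analysis" "HOL-Computational_Algebra.Group_Closure"
begin

section \<open>Point sets in topological abelian groups\<close>

definition compactly_generated :: "'a::topological_ab_group_add itself \<Rightarrow> bool" where
  "compactly_generated _ \<longleftrightarrow>
     (\<exists>W::'a set. compact W \<and> 0 \<in> interior W \<and> group_closure W = UNIV)"

definition relatively_dense :: "'a::topological_ab_group_add set \<Rightarrow> bool" where
  "relatively_dense A \<longleftrightarrow> (\<exists>K. compact K \<and> {a + k |a k. a \<in> A \<and> k \<in> K} = UNIV)"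

definition uniformly_discrete :: "'a::topological_ab_group_add set \<Rightarrow> bool" where
  "uniformly_discrete L \<longleftrightarrow>
     (\<exists>U. open U \<and> 0 \<in> U \<and>
        (\<forall>x\<in>L. \<forall>y\<in>L. x \<noteq> y \<longrightarrow> ((+) x ` U) \<inter> ((+) y ` U) = {}))"

definition delone_set :: "'a::topological_ab_group_add set \<Rightarrow> bool" where
  "delone_set L \<longleftrightarrow> uniformly_discrete L \<and> relatively_dense L"

definition finite_local_complexity :: "'a::topological_ab_group_add set \<Rightarrow> bool" where
  "finite_local_complexity L \<longleftrightarrow>
     (\<forall>K. compact K \<longrightarrow> finite {((+) (- x) ` L) \<inter> K |x. x \<in> L})"

definition periods :: "'a::topological_ab_group_add set \<Rightarrow> 'a set" where
  "periods L = {t. (+) t ` L = L}"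

definition completely_periodic :: "'a::topological_ab_group_add set \<Rightarrow> bool" where
  "completely_periodic L \<longleftrightarrow> relatively_dense (periods L)"

section \<open>Measures and the vague topology\<close>

text \<open>On a group that is not second countable, Borel measures need not be determined by their
  integrals of compactly supported continuous functions.  Radon measures are, which makes the
  vague topology below Hausdorff.\<close>

definition radon_measures :: "'a::t2_space measure set" where
  "radon_measures = {\<mu>. sets \<mu> = sets borel \<and>
     (\<forall>K. compact K \<longrightarrow> emeasure \<mu> K < \<infinity>) \<and>
     (\<forall>A\<in>sets borel. emeasure \<mu> A = (SUP K\<in>{K. compact K \<and> K \<subseteq> A}. emeasure \<mu> K))}"

definition Cc :: "('a::topological_space \<Rightarrow> complex) set" where
  "Cc = {\<phi>. continuous_on UNIV \<phi> \<and> compact (closure {x. \<phi> x \<noteq> 0})}"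

definition vague_topology :: "'a::t2_space measure topology" where
  "vague_topology = topology_generated_by
     {{\<mu> \<in> radon_measures. integral\<^sup>L \<mu> \<phi> \<in> V} |\<phi> V. \<phi> \<in> Cc \<and> open V}"

definition dirac_comb :: "'a::topological_space set \<Rightarrow> 'a measure" where
  "dirac_comb M = distr (count_space M) borel (\<lambda>x. x)"

text \<open>The integral over the counting measure is the sum over the points of \<open>M\<close>, so this is
  the sum of the unit point masses at these points.\<close>

lemma emeasure_dirac_comb:
  assumes "A \<in> sets borel"
  shows "emeasure (dirac_comb M) A = (\<integral>\<^sup>+x. indicator A x \<partial>count_space M)"
proof -
  have "emeasure (dirac_comb M) A = emeasure (count_space M) (A \<inter> M)"
    using assms by (simp add: dirac_comb_def emeasure_distr)
  also have "\<dots> = (\<integral>\<^sup>+x. indicator (A \<inter> M) x \<partial>count_space M)"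
    by simp
  also have "\<dots> = (\<integral>\<^sup>+x. indicator A x \<partial>count_space M)"
    by (rule nn_integral_cong) (auto simp: indicator_def)
  finally show ?thesis .
qed

section \<open>The hull and its dynamical system\<close>

definition hull_space :: "'a::{topological_ab_group_add, t2_space} set \<Rightarrow> 'a measure topology" where
  "hull_space L = subtopology vague_topology
     (vague_topology closure_of {dirac_comb ((+) t ` L) |t. True})"

definition translate_measure ::
    "'a::topological_ab_group_add \<Rightarrow> 'a measure \<Rightarrow> 'a measure" where
  "translate_measure t \<mu> = distr \<mu> borel ((+) t)"

text \<open>On Dirac combs, this is the action by translation of point sets.\<close>

lemma translate_measure_dirac_comb:
  "translate_measure t (dirac_comb M) = dirac_comb ((+) t ` M)"
proof -
  have [measurable]: "(+) t \<in> borel_measurable borel"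
    by (intro borel_measurable_continuous_onI continuous_intros)
  have bij: "bij_betw ((+) t) M ((+) t ` M)"
    by (auto simp: bij_betw_def inj_on_def)
  have "translate_measure t (dirac_comb M) = distr (count_space M) borel ((+) t)"
    unfolding translate_measure_def dirac_comb_def by (subst distr_distr) (auto simp: comp_def)
  also have "\<dots> = distr (distr (count_space M) (count_space ((+) t ` M)) ((+) t)) borel (\<lambda>x. x)"
    by (subst distr_distr) (auto simp: comp_def)
  also have "\<dots> = dirac_comb ((+) t ` M)"
    using bij by (simp add: distr_bij_count_space dirac_comb_def)
  finally show ?thesis .
qed

section \<open>Equicontinuity\<close>

text \<open>A uniform structure on the underlying set of \<open>X\<close>, given as a filter on pairs, that
  induces the topology \<open>X\<close>; the conditions are those of the class \<^class>\<open>uniform_space\<close>,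
  relative to a carrier.\<close>

definition compatible_uniformity :: "'b topology \<Rightarrow> ('b \<times> 'b) filter \<Rightarrow> bool" where
  "compatible_uniformity X \<U> \<longleftrightarrow>
     \<U> \<le> principal (topspace X \<times> topspace X) \<and>
     (\<forall>E. eventually E \<U> \<longrightarrow> (\<forall>x\<in>topspace X. E (x, x))) \<and>
     (\<forall>E. eventually E \<U> \<longrightarrow> eventually (\<lambda>(x, y). E (y, x)) \<U>) \<and>
     (\<forall>E. eventually E \<U> \<longrightarrow>
        (\<exists>D. eventually D \<U> \<and> (\<forall>x y z. D (x, y) \<longrightarrow> D (y, z) \<longrightarrow> E (x, z)))) \<and>
     (\<forall>S. openin X S \<longleftrightarrow>
        S \<subseteq> topspace X \<and> (\<forall>x\<in>S. eventually (\<lambda>(x', y). x' = x \<longrightarrow> y \<in> S) \<U>))"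

text \<open>Meaningful for compact Hausdorff \<open>X\<close>, where there is exactly one compatible
  uniformity.\<close>

definition uniformity_of :: "'b topology \<Rightarrow> ('b \<times> 'b) filter" where
  "uniformity_of X = (THE \<U>. compatible_uniformity X \<U>)"

definition equicontinuous_system :: "'b topology \<Rightarrow> ('g \<Rightarrow> 'b \<Rightarrow> 'b) \<Rightarrow> bool" where
  "equicontinuous_system X act \<longleftrightarrow>
     (\<forall>V. eventually V (uniformity_of X) \<longrightarrow>
        (\<exists>U. eventually U (uniformity_of X) \<and>
           (\<forall>x y. U (x, y) \<longrightarrow> (\<forall>t. V (act t x, act t y)))))"

end

theory Submission
  imports Defs
begin

text \<open>The translates of a completely periodic set are parametrised by a compact set. Its hull is the orbit,
a compact quotient of the group, and its topology comes from the uniformity whose entourages relate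
each point to its small translates. These entourages are invariant under the action because the
group is abelian, so the action is equicontinuous (\<open>compatible_translation_uniformity\<close>,
\<open>completely_periodic_imp_equicontinuous\<close>).

Conversely, let the hull be equicontinuous. It is compact, so finitely many translates \<open>r + L\<close>
approximate every translate \<open>t + L\<close>, and by equicontinuity \<open>t - r\<close> is then an almost period of \<open>L\<close>
uniformly over all translates: \<open>s + (t - r) + L\<close> and \<open>s + L\<close> are vaguely close for all \<open>s\<close>. For such an
almost period \<open>p\<close>, each point \<open>p + x\<close> with \<open>x \<in> L\<close> has a point \<open>p + x + n(x)\<close> of \<open>L\<close> nearby. Finite
local complexity makes the difference set of \<open>L\<close> locally finite, which forces the small correction
\<open>n(x)\<close> to be the same at neighbouring points of \<open>L\<close>. Compact generation joins any two points of \<open>L\<close> by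
a chain of neighbouring points (\<open>relatively_dense_chain_induct\<close>). Hence \<open>n\<close> is constant and \<open>p + n\<close> is
a period (\<open>exists_almost_period_test\<close>). So the periods are relatively dense.

Both directions rest on knowing the uniformity of the hull. A compact space has at most one
compatible uniformity (\<open>compatible_uniformity_le\<close>), so it suffices that the hull is compact and that
the uniformity in use is compatible. For compactness (\<open>compact_hull_space\<close>), every translate of \<open>L\<close> is
\<open>c + M\<close> with \<open>c\<close> in a fixed compact set and \<open>M\<close> a subset of the difference set of \<open>L\<close>. All such combs
form a continuous image of a compact space, and the vague topology is Hausdorff, so that this image
contains the closure of the orbit.\<close>

section \<open>Uniformities on a compact space\<close>

lemma compatible_uniformityD:
  assumes "compatible_uniformity X \<U>"
  shows "eventually (\<lambda>p. p \<in> topspace X \<times> topspace X) \<U>"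
    and "eventually E \<U> \<Longrightarrow> x \<in> topspace X \<Longrightarrow> E (x, x)"
    and "eventually E \<U> \<Longrightarrow> eventually (\<lambda>(x, y). E (y, x)) \<U>"
    and "eventually E \<U> \<Longrightarrow>
           \<exists>D. eventually D \<U> \<and> (\<forall>x y z. D (x, y) \<longrightarrow> D (y, z) \<longrightarrow> E (x, z))"
    and "openin X S \<longleftrightarrow>
        S \<subseteq> topspace X \<and> (\<forall>x\<in>S. eventually (\<lambda>(x', y). x' = x \<longrightarrow> y \<in> S) \<U>)"
proof -
  note * = assms[unfolded compatible_uniformity_def]
  show "eventually (\<lambda>p. p \<in> topspace X \<times> topspace X) \<U>"
    using *[THEN conjunct1] by (simp add: le_principal)
  show "eventually E \<U> \<Longrightarrow> x \<in> topspace X \<Longrightarrow> E (x, x)"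
    using *[THEN conjunct2, THEN conjunct1, THEN spec[of _ E]] by blast
  show "eventually E \<U> \<Longrightarrow> eventually (\<lambda>(x, y). E (y, x)) \<U>"
    using *[THEN conjunct2, THEN conjunct2, THEN conjunct1, THEN spec[of _ E], THEN mp] .
  show "eventually E \<U> \<Longrightarrow>
           \<exists>D. eventually D \<U> \<and> (\<forall>x y z. D (x, y) \<longrightarrow> D (y, z) \<longrightarrow> E (x, z))"
    using *[THEN conjunct2, THEN conjunct2, THEN conjunct2, THEN conjunct1, THEN spec[of _ E], THEN mp] .
  show "openin X S \<longleftrightarrow>
        S \<subseteq> topspace X \<and> (\<forall>x\<in>S. eventually (\<lambda>(x', y). x' = x \<longrightarrow> y \<in> S) \<U>)"
    using *[THEN conjunct2, THEN conjunct2, THEN conjunct2, THEN conjunct2, THEN spec[of _ S]] .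
qed

text \<open>The set \<open>E[x]\<close> itself need not be open. Its interior consists of the points \<open>y\<close> for which some
entourage \<open>D\<close> satisfies \<open>D[y] \<subseteq> E[x]\<close>, and the triangle axiom makes this set open.\<close>

lemma compatible_uniformity_neighbourhood:
  assumes "compatible_uniformity X \<U>" "eventually E \<U>" "x \<in> topspace X"
  obtains S where "openin X S" "x \<in> S" "\<And>y. y \<in> S \<Longrightarrow> E (x, y)"
proof
  define S where "S = {y \<in> topspace X. eventually (\<lambda>(x', z). x' = y \<longrightarrow> E (x, z)) \<U>}"
  note U = compatible_uniformityD[OF assms(1)]
  have "eventually (\<lambda>(x', y). x' = y0 \<longrightarrow> y \<in> S) \<U>" if "y0 \<in> S" for y0
  proof -
    from that have "eventually (\<lambda>(x', z). x' = y0 \<longrightarrow> E (x, z)) \<U>"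
      by (simp add: S_def)
    from U(4)[OF this] obtain D where D: "eventually D \<U>"
      "\<And>z w. D (y0, z) \<Longrightarrow> D (z, w) \<Longrightarrow> E (x, w)" by auto
    from D(1) U(1) show ?thesis
    proof eventually_elim
      case (elim p)
      have "snd p \<in> S" if "fst p = y0"
        using elim that D(2) unfolding S_def
        by (auto intro!: eventually_mono[OF D(1)])
      then show ?case by (auto split: prod.splits)
    qed
  qed
  then show "openin X S" unfolding U(5) by (auto simp: S_def)
  show "x \<in> S" using assms(2,3) by (auto simp: S_def elim!: eventually_mono)
  show "E (x, y)" if "y \<in> S" for y
    using U(2)[of "\<lambda>(x', z). x' = y \<longrightarrow> E (x, z)" y] that by (auto simp: S_def)
qed

text \<open>A continuous map out of a compact space is uniformly continuous; this is that fact for the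
identity map between two uniformities with the same topology. Around each point \<open>x\<close> there is a
\<open>\<U>\<close>-entourage \<open>T x\<close> for which points two \<open>T x\<close>-steps away from \<open>x\<close> are still \<open>V'\<close>-close to \<open>x\<close>, and
finitely many of the neighbourhoods on which one step suffices cover the space.\<close>

lemma compatible_uniformity_le:
  assumes "compact_space X" "compatible_uniformity X \<U>" "compatible_uniformity X \<V>"
  shows "\<U> \<le> \<V>"
proof (rule filter_leI)
  fix V assume "eventually V \<V>"
  note U = compatible_uniformityD[OF assms(2)] and V = compatible_uniformityD[OF assms(3)]
  obtain D where D: "eventually D \<V>" "\<And>x y z. D (x, y) \<Longrightarrow> D (y, z) \<Longrightarrow> V (x, z)"
    using V(4)[OF \<open>eventually V \<V>\<close>] by blast
  define V' where "V' = (\<lambda>(x, y). D (x, y) \<and> D (y, x))"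
  have V': "eventually V' \<V>"
    using D(1) V(3)[OF D(1)] unfolding V'_def by eventually_elim auto
  have "\<exists>T S. eventually T \<U> \<and> openin X S \<and> x \<in> S \<and> (\<forall>y\<in>S. T (x, y)) \<and>
        (\<forall>y z. T (x, y) \<longrightarrow> T (y, z) \<longrightarrow> V' (x, z))" if x: "x \<in> topspace X" for x
  proof -
    obtain O' where O': "openin X O'" "x \<in> O'" "\<And>y. y \<in> O' \<Longrightarrow> V' (x, y)"
      using compatible_uniformity_neighbourhood[OF assms(3) V' x] by metis
    then have "eventually (\<lambda>(x', y). x' = x \<longrightarrow> y \<in> O') \<U>" using U(5)[of O'] by simp
    from U(4)[OF this] obtain T where T: "eventually T \<U>"
      "\<And>z w. T (x, z) \<Longrightarrow> T (z, w) \<Longrightarrow> w \<in> O'" by auto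
    obtain S where "openin X S" "x \<in> S" "\<And>y. y \<in> S \<Longrightarrow> T (x, y)"
      using compatible_uniformity_neighbourhood[OF assms(2) T(1) x] by metis
    with T O'(3) show ?thesis by (intro exI[of _ T] exI[of _ S]) simp
  qed
  then have ex: "\<forall>x\<in>topspace X. \<exists>p. eventually (fst p) \<U> \<and> openin X (snd p) \<and> x \<in> snd p \<and>
      (\<forall>y\<in>snd p. fst p (x, y)) \<and> (\<forall>y z. fst p (x, y) \<longrightarrow> fst p (y, z) \<longrightarrow> V' (x, z))"
    by simp
  obtain p where p: "\<forall>x\<in>topspace X. eventually (fst (p x)) \<U> \<and> openin X (snd (p x)) \<and>
      x \<in> snd (p x) \<and> (\<forall>y\<in>snd (p x). fst (p x) (x, y)) \<and>
      (\<forall>y z. fst (p x) (x, y) \<longrightarrow> fst (p x) (y, z) \<longrightarrow> V' (x, z))"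
    using bchoice[OF ex] by (rule exE)
  define T where "T = (\<lambda>x. fst (p x))"
  define S where "S = (\<lambda>x. snd (p x))"
  have TS: "eventually (T x) \<U>" "openin X (S x)" "x \<in> S x" "\<And>y. y \<in> S x \<Longrightarrow> T x (x, y)"
    "\<And>y z. T x (x, y) \<Longrightarrow> T x (y, z) \<Longrightarrow> V' (x, z)" if "x \<in> topspace X" for x
    using bspec[OF p that] unfolding T_def S_def by simp_all
  obtain F where F: "finite F" "F \<subseteq> topspace X" "topspace X \<subseteq> (\<Union>x\<in>F. S x)"
  proof -
    have "\<exists>\<F>. finite \<F> \<and> \<F> \<subseteq> S ` topspace X \<and> topspace X \<subseteq> \<Union>\<F>"
      using spec[OF assms(1)[unfolded compact_space_alt], of "S ` topspace X"] TS(2,3) by auto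
    then obtain \<F> where "finite \<F>" "\<F> \<subseteq> S ` topspace X" and cov: "topspace X \<subseteq> \<Union>\<F>"
      by (elim exE conjE)
    moreover from this obtain F where "F \<subseteq> topspace X" "finite F" "\<F> = S ` F"
      by (meson finite_subset_image)
    ultimately show ?thesis using that by simp
  qed
  have "eventually (\<lambda>p. \<forall>x\<in>F. T x p) \<U>"
    using F TS(1) by (intro eventually_ball_finite) auto
  then show "eventually V \<U>" using U(1)
  proof eventually_elim
    case (elim p)
    \<comment> \<open>For \<open>y \<in> S x\<close>, both \<open>y\<close> and \<open>z\<close> are two \<open>T x\<close>-steps away from \<open>x\<close>; the reflexive step at \<open>y\<close> makes up for the missing one.\<close>
    obtain y z where p: "p = (y, z)" by force
    from elim p F obtain x where x: "x \<in> F" "y \<in> S x" by auto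
    have xX: "x \<in> topspace X" using x F by auto
    have 1: "T x (x, y)" "T x (y, z)" using TS(4)[OF xX x(2)] x elim p by auto
    have 2: "T x (y, y)" using U(2)[OF TS(1)[OF xX], of y] elim p by auto
    have "V' (x, y)" "V' (x, z)" using TS(5)[OF xX 1(1) 2] TS(5)[OF xX 1] by auto
    then show ?case using D(2) p by (auto simp: V'_def)
  qed
qed

text \<open>Equicontinuity may therefore be tested with any uniformity known to induce the topology. The two
implications of the theorem use two different ones.\<close>

lemma uniformity_of_eqI:
  assumes "compact_space X" "compatible_uniformity X \<U>"
  shows "uniformity_of X = \<U>"
  unfolding uniformity_of_def
  using assms by (intro the_equality antisym compatible_uniformity_le)

text \<open>The finite net is chosen inside \<open>A\<close>, which need not be closed: a finite cover by \<open>D\<close>-small sets is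
turned into a net by picking one point of \<open>A\<close> in every member that meets \<open>A\<close>.\<close>

lemma compatible_uniformity_totally_bounded:
  assumes "compact_space X" "compatible_uniformity X \<U>" "eventually E \<U>" "A \<subseteq> topspace X"
  obtains F where "finite F" "F \<subseteq> A" "\<And>x. x \<in> A \<Longrightarrow> \<exists>y\<in>F. E (x, y)"
proof -
  note U = compatible_uniformityD[OF assms(2)]
  obtain D where D: "eventually D \<U>" "\<And>x y z. D (x, y) \<Longrightarrow> D (y, z) \<Longrightarrow> E (x, z)"
    using U(4)[OF assms(3)] by auto
  define D' where "D' = (\<lambda>(x, y). D (x, y) \<and> D (y, x))"
  have D': "eventually D' \<U>"
    using D(1) U(3)[OF D(1)] unfolding D'_def by eventually_elim auto
  have "\<exists>S. openin X S \<and> x \<in> S \<and> (\<forall>y\<in>S. D' (x, y))" if "x \<in> topspace X" for x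
    using compatible_uniformity_neighbourhood[OF assms(2) D' that] by metis
  then have ex: "\<forall>x\<in>topspace X. \<exists>S. openin X S \<and> x \<in> S \<and> (\<forall>y\<in>S. D' (x, y))" by simp
  obtain S where S: "\<forall>x\<in>topspace X. openin X (S x) \<and> x \<in> S x \<and> (\<forall>y\<in>S x. D' (x, y))"
    using bchoice[OF ex] by (rule exE)
  have "\<exists>\<F>. finite \<F> \<and> \<F> \<subseteq> S ` topspace X \<and> topspace X \<subseteq> \<Union>\<F>"
    using spec[OF assms(1)[unfolded compact_space_alt], of "S ` topspace X"] S by auto
  then obtain \<F> where F: "finite \<F>" "\<F> \<subseteq> S ` topspace X" "topspace X \<subseteq> \<Union>\<F>"
    by (elim exE conjE)
  define pick where "pick = (\<lambda>P. SOME a. a \<in> P \<inter> A)"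
  define F where "F = pick ` {P \<in> \<F>. P \<inter> A \<noteq> {}}"
  have pick: "pick P \<in> P \<inter> A" if "P \<inter> A \<noteq> {}" for P
    using that unfolding pick_def by (intro someI_ex[of "\<lambda>a. a \<in> P \<inter> A"]) blast
  have "\<exists>y\<in>F. E (x, y)" if x: "x \<in> A" for x
  proof -
    obtain P where P: "P \<in> \<F>" "x \<in> P" using F(3) x assms(4) by blast
    then have ne: "P \<inter> A \<noteq> {}" using x by blast
    obtain z where z: "z \<in> topspace X" "P = S z" using P(1) F(2) by blast
    have "D' (z, x)" "D' (z, pick P)" using S z P(2) pick[OF ne] by auto
    then have "E (x, pick P)" using D(2) unfolding D'_def by auto
    moreover have "pick P \<in> F" using P(1) ne by (auto simp: F_def)
    ultimately show ?thesis by blast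
  qed
  moreover have "finite F" "F \<subseteq> A" using F(1) pick by (auto simp: F_def)
  ultimately show ?thesis using that by blast
qed

section \<open>The uniformity of the vague topology\<close>

definition vague_close :: "('a::t2_space \<Rightarrow> complex) set \<Rightarrow> real \<Rightarrow> 'a measure \<Rightarrow> 'a measure \<Rightarrow> bool" where
  "vague_close \<Phi> e \<mu> \<nu> \<longleftrightarrow> (\<forall>\<phi>\<in>\<Phi>. dist (integral\<^sup>L \<mu> \<phi>) (integral\<^sup>L \<nu> \<phi>) < e)"

definition vague_uniformity :: "'a::t2_space measure set \<Rightarrow> ('a measure \<times> 'a measure) filter" where
  "vague_uniformity A = (INF (\<Phi>, e)\<in>{(\<Phi>, e). finite \<Phi> \<and> \<Phi> \<subseteq> Cc \<and> e > 0}.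
     principal {(\<mu>, \<nu>). \<mu> \<in> A \<and> \<nu> \<in> A \<and> vague_close \<Phi> e \<mu> \<nu>})"

text \<open>The sets given by finitely many test functions and one tolerance are closed under intersection up
to shrinking, so they are a base of the filter that they generate.\<close>

lemma eventually_vague_uniformity:
  "eventually E (vague_uniformity A) \<longleftrightarrow>
     (\<exists>\<Phi> e. finite \<Phi> \<and> \<Phi> \<subseteq> Cc \<and> e > 0 \<and> (\<forall>\<mu>\<in>A. \<forall>\<nu>\<in>A. vague_close \<Phi> e \<mu> \<nu> \<longrightarrow> E (\<mu>, \<nu>)))"
proof -
  define I :: "(('a \<Rightarrow> complex) set \<times> real) set" where "I = {(\<Phi>, e). finite \<Phi> \<and> \<Phi> \<subseteq> Cc \<and> e > 0}"
  define W :: "('a \<Rightarrow> complex) set \<times> real \<Rightarrow> ('a measure \<times> 'a measure) set"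
    where "W = (\<lambda>(\<Phi>, e). {(\<mu>, \<nu>). \<mu> \<in> A \<and> \<nu> \<in> A \<and> vague_close \<Phi> e \<mu> \<nu>})"
  have *: "vague_uniformity A = (INF i\<in>I. principal (W i))"
    unfolding vague_uniformity_def I_def W_def by (intro INF_cong) auto
  have "({}, 1) \<in> I" by (simp add: I_def)
  then have "I \<noteq> {}" by blast
  moreover have "\<exists>k\<in>I. principal (W k) \<le> inf (principal (W i)) (principal (W j))"
    if "i \<in> I" "j \<in> I" for i j
  proof (rule bexI[of _ "(fst i \<union> fst j, min (snd i) (snd j))"])
    show "principal (W (fst i \<union> fst j, min (snd i) (snd j))) \<le> inf (principal (W i)) (principal (W j))"
      unfolding inf_principal principal_le_iff W_def vague_close_def
      by (cases i; cases j) (simp add: subset_iff)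
    show "(fst i \<union> fst j, min (snd i) (snd j)) \<in> I"
      using that unfolding I_def by (cases i; cases j) simp
  qed
  ultimately have "eventually E (vague_uniformity A) \<longleftrightarrow> (\<exists>i\<in>I. \<forall>p\<in>W i. E p)"
    unfolding * by (subst eventually_INF_base) (simp_all add: eventually_principal)
  then show ?thesis by (simp add: I_def W_def Bex_def Ball_def imp_conjL)
qed

lemma topspace_vague_topology: "topspace vague_topology = radon_measures"
proof -
  have "(\<lambda>_. 0) \<in> Cc" by (simp add: Cc_def)
  then show ?thesis
    unfolding vague_topology_def topology_generated_by_topspace
    by (auto intro!: exI[of _ "radon_measures"] exI[of _ UNIV])
qed

lemma openin_vague_close:
  assumes "finite \<Phi>" "\<Phi> \<subseteq> Cc"
  shows "openin vague_topology {\<nu> \<in> radon_measures. vague_close \<Phi> e \<mu> \<nu>}"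
proof -
  have "openin vague_topology {\<nu> \<in> radon_measures. integral\<^sup>L \<nu> \<phi> \<in> ball (integral\<^sup>L \<mu> \<phi>) e}"
    if "\<phi> \<in> \<Phi>" for \<phi>
    unfolding vague_topology_def using assms that
    by (intro topology_generated_by_Basis) blast
  then have "openin vague_topology
     (topspace vague_topology \<inter> \<Inter>((\<lambda>\<phi>. {\<nu> \<in> radon_measures. integral\<^sup>L \<nu> \<phi> \<in> ball (integral\<^sup>L \<mu> \<phi>) e}) ` \<Phi>))"
    using assms by (intro openin_Int_Inter) auto
  moreover have "topspace vague_topology \<inter> \<Inter>((\<lambda>\<phi>. {\<nu> \<in> radon_measures. integral\<^sup>L \<nu> \<phi> \<in> ball (integral\<^sup>L \<mu> \<phi>) e}) ` \<Phi>)
      = {\<nu> \<in> radon_measures. vague_close \<Phi> e \<mu> \<nu>}"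
    by (auto simp: topspace_vague_topology vague_close_def)
  ultimately show ?thesis by simp
qed

text \<open>The generators of the vague topology prescribe one integral only; induction over the generated
topology collects the finitely many test functions that are needed around a point.\<close>

lemma openin_vague_topologyD:
  assumes "openin vague_topology T" "\<mu> \<in> T"
  shows "\<exists>\<Phi> e. finite \<Phi> \<and> \<Phi> \<subseteq> Cc \<and> e > 0 \<and> (\<forall>\<nu>\<in>radon_measures. vague_close \<Phi> e \<mu> \<nu> \<longrightarrow> \<nu> \<in> T)"
proof -
  have "generate_topology_on {{\<mu> \<in> radon_measures. integral\<^sup>L \<mu> \<phi> \<in> V} |\<phi> V. \<phi> \<in> Cc \<and> open V} T"
    using assms(1) unfolding vague_topology_def openin_topology_generated_by_iff .
  then show ?thesis using assms(2)
  proof (induction arbitrary: \<mu> rule: generate_topology_on.induct)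
    case Empty
    then show ?case by simp
  next
    case (Int a b)
    from Int.IH(1)[of \<mu>] Int.prems obtain \<Phi> e where 1: "finite \<Phi>" "\<Phi> \<subseteq> Cc" "e > 0"
      "\<And>\<nu>. \<nu>\<in>radon_measures \<Longrightarrow> vague_close \<Phi> e \<mu> \<nu> \<Longrightarrow> \<nu> \<in> a" by blast
    from Int.IH(2)[of \<mu>] Int.prems obtain \<Phi>' e' where 2: "finite \<Phi>'" "\<Phi>' \<subseteq> Cc" "e' > 0"
      "\<And>\<nu>. \<nu>\<in>radon_measures \<Longrightarrow> vague_close \<Phi>' e' \<mu> \<nu> \<Longrightarrow> \<nu> \<in> b" by blast
    show ?case
      using 1 2 by (intro exI[of _ "\<Phi> \<union> \<Phi>'"] exI[of _ "min e e'"]) (auto simp: vague_close_def)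
  next
    case (UN K)
    from UN.prems obtain k where k: "k \<in> K" "\<mu> \<in> k" by (rule UnionE)
    from UN.IH[OF k] obtain \<Phi> e where 1: "finite \<Phi>" "\<Phi> \<subseteq> Cc" "e > 0"
      "\<forall>\<nu>\<in>radon_measures. vague_close \<Phi> e \<mu> \<nu> \<longrightarrow> \<nu> \<in> k" by (elim exE conjE)
    with k(1) show ?case by (intro exI[of _ \<Phi>] exI[of _ e]) auto
  next
    case (Basis s)
    then obtain \<phi> V where s: "s = {\<mu> \<in> radon_measures. integral\<^sup>L \<mu> \<phi> \<in> V}" "\<phi> \<in> Cc" "open V" by blast
    with Basis.prems obtain e where "e > 0" "ball (integral\<^sup>L \<mu> \<phi>) e \<subseteq> V"
      unfolding open_contains_ball by blast
    with s show ?case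
      by (intro exI[of _ "{\<phi>}"] exI[of _ e]) (auto simp: vague_close_def)
  qed
qed

lemma compatible_vague_uniformity:
  assumes "A \<subseteq> radon_measures"
  shows "compatible_uniformity (subtopology vague_topology A) (vague_uniformity A)"
proof -
  have top: "topspace (subtopology vague_topology A) = A"
    using assms by (auto simp: topspace_vague_topology)
  have half: "\<exists>D. eventually D (vague_uniformity A) \<and> (\<forall>x y z. D (x, y) \<longrightarrow> D (y, z) \<longrightarrow> E (x, z))"
    if "eventually E (vague_uniformity A)" for E
  proof -
    from that obtain \<Phi> e where *: "finite \<Phi>" "\<Phi> \<subseteq> Cc" "e > 0"
      "\<forall>\<mu>\<in>A. \<forall>\<nu>\<in>A. vague_close \<Phi> e \<mu> \<nu> \<longrightarrow> E (\<mu>, \<nu>)"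
      unfolding eventually_vague_uniformity by blast
    define D where "D = (\<lambda>(\<mu>, \<nu>). \<mu> \<in> A \<and> \<nu> \<in> A \<and> vague_close \<Phi> (e/2) \<mu> \<nu>)"
    have "eventually D (vague_uniformity A)"
      unfolding eventually_vague_uniformity using * by (intro exI[of _ \<Phi>] exI[of _ "e/2"]) (auto simp: D_def)
    moreover have "E (x, z)" if "D (x, y)" "D (y, z)" for x y z
    proof -
      have "dist (integral\<^sup>L x \<phi>) (integral\<^sup>L z \<phi>) < e" if "\<phi> \<in> \<Phi>" for \<phi>
      proof -
        have "dist (integral\<^sup>L x \<phi>) (integral\<^sup>L y \<phi>) < e/2" "dist (integral\<^sup>L y \<phi>) (integral\<^sup>L z \<phi>) < e/2"
          using \<open>D (x, y)\<close> \<open>D (y, z)\<close> that by (auto simp: D_def vague_close_def)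
        with dist_triangle[of "integral\<^sup>L x \<phi>" "integral\<^sup>L z \<phi>" "integral\<^sup>L y \<phi>"] show ?thesis by linarith
      qed
      with that *(4) show ?thesis by (auto simp: D_def vague_close_def)
    qed
    ultimately show ?thesis by blast
  qed
  have opn: "openin (subtopology vague_topology A) S \<longleftrightarrow>
        S \<subseteq> A \<and> (\<forall>x\<in>S. eventually (\<lambda>(x', y). x' = x \<longrightarrow> y \<in> S) (vague_uniformity A))" (is "?l \<longleftrightarrow> ?r") for S
  proof
    assume ?l
    then obtain T where T: "openin vague_topology T" "S = T \<inter> A" by (auto simp: openin_subtopology)
    have "eventually (\<lambda>(x', y). x' = x \<longrightarrow> y \<in> S) (vague_uniformity A)" if "x \<in> S" for x
    proof -
      from that T(2) have "x \<in> T" by simp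
      from openin_vague_topologyD[OF T(1) this] obtain \<Phi> e where "finite \<Phi>" "\<Phi> \<subseteq> Cc" "e > 0"
        "\<forall>\<nu>\<in>radon_measures. vague_close \<Phi> e x \<nu> \<longrightarrow> \<nu> \<in> T" by (elim exE conjE)
      with T(2) assms show ?thesis
        unfolding eventually_vague_uniformity split by (intro exI[of _ \<Phi>] exI[of _ e]) auto
    qed
    with T show ?r by auto
  next
    assume r: ?r
    show ?l
    proof (subst openin_subopen, intro ballI)
      fix x assume x: "x \<in> S"
      with r obtain \<Phi> e where *: "finite \<Phi>" "\<Phi> \<subseteq> Cc" "e > 0"
        "\<forall>\<mu>\<in>A. \<forall>\<nu>\<in>A. vague_close \<Phi> e \<mu> \<nu> \<longrightarrow> \<mu> = x \<longrightarrow> \<nu> \<in> S"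
        unfolding eventually_vague_uniformity split by (elim conjE ballE[of S _ x]) auto
      show "\<exists>T. openin (subtopology vague_topology A) T \<and> x \<in> T \<and> T \<subseteq> S"
        using * x r assms openin_vague_close[OF *(1,2), of e x]
        by (intro exI[of _ "{\<nu> \<in> radon_measures. vague_close \<Phi> e x \<nu>} \<inter> A"])
           (auto simp: openin_subtopology vague_close_def)
    qed
  qed
  have carrier: "vague_uniformity A \<le> principal (A \<times> A)"
    unfolding le_principal eventually_vague_uniformity
    by (intro exI[of _ "{}"] exI[of _ 1]) auto
  have refl: "E (x, x)" if "eventually E (vague_uniformity A)" "x \<in> A" for E x
  proof -
    from that(1) obtain \<Phi> e where *: "e > 0"
      "\<forall>\<mu>\<in>A. \<forall>\<nu>\<in>A. vague_close \<Phi> e \<mu> \<nu> \<longrightarrow> E (\<mu>, \<nu>)"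
      unfolding eventually_vague_uniformity by blast
    moreover have "vague_close \<Phi> e x x" using * by (simp add: vague_close_def)
    ultimately show ?thesis using that(2) by blast
  qed
  have sym: "eventually (\<lambda>(x, y). E (y, x)) (vague_uniformity A)"
    if "eventually E (vague_uniformity A)" for E
  proof -
    have comm: "vague_close \<Phi> e \<mu> \<nu> \<longleftrightarrow> vague_close \<Phi> e \<nu> \<mu>" for \<Phi> e and \<mu> \<nu> :: "'a measure"
      by (simp add: vague_close_def dist_commute)
    from that show ?thesis
      unfolding eventually_vague_uniformity split using comm by meson
  qed
  show ?thesis
    unfolding compatible_uniformity_def top
    using carrier refl sym half opn by (intro conjI allI impI ballI) simp_all
qed

section \<open>The vague topology is Hausdorff\<close>

lemma Hausdorff_space_euclidean_t2: "Hausdorff_space (euclidean :: 'a::t2_space topology)"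
  unfolding Hausdorff_space_def disjnt_def using hausdorff by auto

lemma locally_compact_neighbourhood:
  fixes K :: "'a::t2_space set"
  assumes "locally_compact_space (euclidean :: 'a topology)" "compact K"
  obtains U C where "open U" "compact C" "K \<subseteq> U" "U \<subseteq> C"
proof -
  have "\<exists>U L. openin euclidean U \<and> compactin euclidean L \<and> closedin euclidean L \<and> K \<subseteq> U \<and> U \<subseteq> L"
    using assms locally_compact_space_compact_closed_compact[of "euclidean :: 'a topology"]
    by (simp add: Hausdorff_space_euclidean_t2)
  then show ?thesis using that by auto
qed

lemma locally_compact_Urysohn:
  fixes K :: "'a::t2_space set"
  assumes lc: "locally_compact_space (euclidean :: 'a topology)"
    and "compact K" "open V" "K \<subseteq> V"
  obtains g :: "'a \<Rightarrow> real" where "continuous_on UNIV g" "\<And>x. 0 \<le> g x" "\<And>x. g x \<le> 1"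
    "\<And>x. x \<in> K \<Longrightarrow> g x = 1" "\<And>x. x \<notin> V \<Longrightarrow> g x = 0" "compact (closure {x. g x \<noteq> 0})"
proof -
  obtain U C where UC: "open U" "compact C" "K \<subseteq> U" "U \<subseteq> C"
    using locally_compact_neighbourhood[OF lc \<open>compact K\<close>] .
  have cr: "completely_regular_space (euclidean :: 'a topology)"
    using lc by (intro locally_compact_regular_imp_completely_regular_space
      locally_compact_Hausdorff_imp_regular_space disjI2)
      (simp_all add: Hausdorff_space_euclidean_t2)
  have cl: "closedin euclidean (- (U \<inter> V))" using UC assms by (simp only: closed_closedin[symmetric] closed_Compl open_Int)
  have dj: "disjnt K (- (U \<inter> V))" using UC assms by (auto simp: disjnt_def)
  obtain g :: "'a \<Rightarrow> real" where g: "continuous_map euclidean (top_of_set {0..1}) g"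
    "g ` (- (U \<inter> V)) \<subseteq> {0}" "g ` K \<subseteq> {1}"
    using Urysohn_completely_regular_compact_closed[OF zero_le_one cr _ cl dj] \<open>compact K\<close> by auto
  have cont: "continuous_on UNIV g" and range: "g x \<in> {0..1}" for x
    using g(1) by (auto simp: continuous_map_in_subtopology)
  have "{x. g x \<noteq> 0} \<subseteq> C" using g(2) UC(4) by auto
  then have "closure {x. g x \<noteq> 0} \<subseteq> C"
    using UC(2) by (intro closure_minimal compact_imp_closed)
  then have "compact (closure {x. g x \<noteq> 0})"
    using compact_Int_closed[OF UC(2) closed_closure[of "{x. g x \<noteq> 0}"]] by (simp add: Int_absorb1)
  with cont range g show ?thesis by (intro that[of g]) auto
qed

lemma of_real_in_Cc:
  fixes g :: "'a::topological_space \<Rightarrow> real"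
  assumes "continuous_on UNIV g" "compact (closure {x. g x \<noteq> 0})"
  shows "(\<lambda>x. complex_of_real (g x)) \<in> Cc"
  using assms by (auto simp: Cc_def intro: continuous_intros)

text \<open>Inner regularity is applied to \<open>U - K\<close>, where \<open>U\<close> is a relatively compact neighbourhood of \<open>K\<close>:
removing from \<open>U\<close> a compact part of \<open>U - K\<close> that carries almost all of its measure leaves an open
neighbourhood of \<open>K\<close> of almost the measure of \<open>K\<close>.\<close>

lemma radon_measure_outer_regular:
  fixes \<mu> :: "'a::t2_space measure"
  assumes lc: "locally_compact_space (euclidean :: 'a topology)"
    and \<mu>: "\<mu> \<in> radon_measures" and K: "compact K" and "e > 0"
  obtains V where "open V" "K \<subseteq> V" "emeasure \<mu> V \<le> emeasure \<mu> K + ennreal e"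
proof -
  have sets: "sets \<mu> = sets borel" and fin: "\<And>K. compact K \<Longrightarrow> emeasure \<mu> K < \<infinity>"
    and inner: "\<And>A. A \<in> sets borel \<Longrightarrow> emeasure \<mu> A = (SUP K\<in>{K. compact K \<and> K \<subseteq> A}. emeasure \<mu> K)"
    using \<mu> by (auto simp: radon_measures_def)
  obtain U C where UC: "open U" "compact C" "K \<subseteq> U" "U \<subseteq> C"
    using locally_compact_neighbourhood[OF lc K] .
  have clK: "closed K" using K by (rule compact_imp_closed)
  define A where "A = U - K"
  have A: "A \<in> sets borel" unfolding A_def using UC clK by (simp add: borel_open open_Diff)
  have Cs: "C \<in> sets borel" using UC by (simp add: borel_closed compact_imp_closed)
  have "emeasure \<mu> A \<le> emeasure \<mu> C"
    using UC Cs by (intro emeasure_mono) (auto simp: A_def sets)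
  with fin[OF UC(2)] have finA: "emeasure \<mu> A < \<infinity>" by simp
  have "\<exists>K'\<in>{K. compact K \<and> K \<subseteq> A}. emeasure \<mu> A < emeasure \<mu> K' + ennreal e"
    using finA by (intro SUP_approx_ennreal[OF \<open>e > 0\<close> _ inner[OF A]]) auto
  then obtain K' where K': "compact K'" "K' \<subseteq> A" "emeasure \<mu> A < emeasure \<mu> K' + ennreal e" by auto
  have clK': "closed K'" using K'(1) by (rule compact_imp_closed)
  have "emeasure \<mu> (A - K') = emeasure \<mu> A - emeasure \<mu> K'"
    using K' A clK' fin[OF K'(1)] by (intro emeasure_Diff) (auto simp: sets borel_closed)
  also have "\<dots> \<le> ennreal e"
    using K'(3) fin[OF K'(1)] by (auto simp: ennreal_minus_le_iff less_imp_le add.commute)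
  finally have small: "emeasure \<mu> (A - K') \<le> ennreal e" .
  have "U - K' = K \<union> (A - K')" using UC K'(2) by (auto simp: A_def)
  then have "emeasure \<mu> (U - K') \<le> emeasure \<mu> K + emeasure \<mu> (A - K')"
    using clK clK' A by (simp add: emeasure_subadditive sets borel_closed sets.Diff)
  with small have "emeasure \<mu> (U - K') \<le> emeasure \<mu> K + ennreal e"
    by (meson add_left_mono order_trans)
  moreover have "open (U - K')" "K \<subseteq> U - K'"
    using UC clK' K'(2) by (auto simp: A_def)
  ultimately show ?thesis using that by blast
qed

text \<open>A Urysohn function \<open>g\<close> between \<open>K\<close> and a neighbourhood \<open>V\<close> with \<open>\<mu> V \<le> \<mu> K + e\<close> gives
\<open>\<nu> K \<le> \<integral>g d\<nu> = \<integral>g d\<mu> \<le> \<mu> V\<close>. So the measures agree on compact sets, and inner regularity extends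
this to all Borel sets.\<close>

lemma radon_measure_eqI:
  fixes \<mu> \<nu> :: "'a::t2_space measure"
  assumes lc: "locally_compact_space (euclidean :: 'a topology)"
    and \<mu>: "\<mu> \<in> radon_measures" and \<nu>: "\<nu> \<in> radon_measures"
    and eq: "\<And>\<phi>. \<phi> \<in> Cc \<Longrightarrow> integral\<^sup>L \<mu> \<phi> = integral\<^sup>L \<nu> \<phi>"
  shows "\<mu> = \<nu>"
proof -
  have le: "emeasure \<nu> K \<le> emeasure \<mu> K"
    if \<mu>: "\<mu> \<in> radon_measures" and \<nu>: "\<nu> \<in> radon_measures" and K: "compact K"
      and eq: "\<And>\<phi>. \<phi> \<in> Cc \<Longrightarrow> integral\<^sup>L \<mu> \<phi> = integral\<^sup>L \<nu> \<phi>" for \<mu> \<nu> :: "'a measure" and K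
  proof (rule ennreal_le_epsilon)
    fix e :: real assume "e > 0"
    obtain V where V: "open V" "K \<subseteq> V" "emeasure \<mu> V \<le> emeasure \<mu> K + ennreal e"
      using radon_measure_outer_regular[OF lc \<mu> K \<open>e > 0\<close>] .
    obtain g :: "'a \<Rightarrow> real" where g: "continuous_on UNIV g" "\<And>x. 0 \<le> g x" "\<And>x. g x \<le> 1"
      "\<And>x. x \<in> K \<Longrightarrow> g x = 1" "\<And>x. x \<notin> V \<Longrightarrow> g x = 0" "compact (closure {x. g x \<noteq> 0})"
      using locally_compact_Urysohn[OF lc K V(1,2)] by blast
    have int: "integrable \<rho> g" if \<rho>: "\<rho> \<in> radon_measures" for \<rho>
    proof (rule integrableI_bounded)
      have s: "sets \<rho> = sets borel" using \<rho> by (simp add: radon_measures_def)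
      have "g \<in> borel_measurable borel" using g(1) by (rule borel_measurable_continuous_onI)
      then show "g \<in> borel_measurable \<rho>" by (subst measurable_cong_sets[OF s refl])
      have clo: "x \<in> closure {x. g x \<noteq> 0}" if "g x \<noteq> 0" for x
        using that closure_subset[of "{x. g x \<noteq> 0}"] by auto
      have "(\<integral>\<^sup>+x. ennreal (norm (g x)) \<partial>\<rho>) \<le> (\<integral>\<^sup>+x. indicator (closure {x. g x \<noteq> 0}) x \<partial>\<rho>)"
        using g(2,3) clo by (intro nn_integral_mono) (auto simp: indicator_def)
      also have "\<dots> = emeasure \<rho> (closure {x. g x \<noteq> 0})"
        by (intro nn_integral_indicator) (simp add: s)
      also have "\<dots> < \<infinity>" using \<rho> g(6) unfolding radon_measures_def by blast
      finally show "(\<integral>\<^sup>+x. ennreal (norm (g x)) \<partial>\<rho>) < \<infinity>" .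
    qed
    have "complex_of_real (integral\<^sup>L \<mu> g) = complex_of_real (integral\<^sup>L \<nu> g)"
      using eq[OF of_real_in_Cc[OF g(1,6)]] by (simp only: integral_complex_of_real)
    then have eqg: "integral\<^sup>L \<mu> g = integral\<^sup>L \<nu> g" by simp
    have s: "sets \<mu> = sets borel" "sets \<nu> = sets borel" using \<mu> \<nu> by (simp_all add: radon_measures_def)
    have "emeasure \<nu> K = (\<integral>\<^sup>+x. indicator K x \<partial>\<nu>)"
      using K by (simp add: s borel_closed compact_imp_closed)
    also have "\<dots> \<le> (\<integral>\<^sup>+x. ennreal (g x) \<partial>\<nu>)"
      using g(2,4) by (intro nn_integral_mono) (auto simp: indicator_def)
    also have "\<dots> = ennreal (integral\<^sup>L \<nu> g)"
      using int[OF \<nu>] g(2) by (simp add: nn_integral_eq_integral)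
    also have "\<dots> = (\<integral>\<^sup>+x. ennreal (g x) \<partial>\<mu>)"
      using int[OF \<mu>] g(2) by (simp add: nn_integral_eq_integral eqg)
    also have "\<dots> \<le> (\<integral>\<^sup>+x. indicator V x \<partial>\<mu>)"
      using g(3,5) by (intro nn_integral_mono) (auto simp: indicator_def)
    also have "\<dots> = emeasure \<mu> V"
      using V(1) by (simp add: s)
    finally show "emeasure \<nu> K \<le> emeasure \<mu> K + ennreal e" using V(3) by simp
  qed
  have K: "emeasure \<mu> K = emeasure \<nu> K" if "compact K" for K
    using le[OF \<mu> \<nu> that eq] le[OF \<nu> \<mu> that eq[symmetric]] by (rule antisym[rotated])
  show ?thesis
  proof (rule measure_eqI)
    show "sets \<mu> = sets \<nu>" using \<mu> \<nu> by (simp add: radon_measures_def)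
    fix A assume "A \<in> sets \<mu>"
    then have A: "A \<in> sets borel" using \<mu> by (simp add: radon_measures_def)
    have "emeasure \<mu> A = (SUP K\<in>{K. compact K \<and> K \<subseteq> A}. emeasure \<mu> K)"
      using \<mu> A by (simp add: radon_measures_def)
    also have "\<dots> = (SUP K\<in>{K. compact K \<and> K \<subseteq> A}. emeasure \<nu> K)"
      using K by (intro SUP_cong) auto
    also have "\<dots> = emeasure \<nu> A" using \<nu> A by (simp add: radon_measures_def)
    finally show "emeasure \<mu> A = emeasure \<nu> A" .
  qed
qed

text \<open>This is what makes compact sets of measures closed, so that the closure of an orbit can be found
inside any compact set that contains the orbit.\<close>

lemma Hausdorff_vague_topology:
  assumes lc: "locally_compact_space (euclidean :: 'a::t2_space topology)"
  shows "Hausdorff_space (vague_topology :: 'a measure topology)"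
  unfolding Hausdorff_space_def topspace_vague_topology
proof (intro allI impI)
  fix \<mu> \<nu> :: "'a measure"
  assume "\<mu> \<in> radon_measures \<and> \<nu> \<in> radon_measures \<and> \<mu> \<noteq> \<nu>"
  then have *: "\<mu> \<in> radon_measures" "\<nu> \<in> radon_measures" "\<mu> \<noteq> \<nu>" by auto
  obtain \<phi> where \<phi>: "\<phi> \<in> Cc" "integral\<^sup>L \<mu> \<phi> \<noteq> integral\<^sup>L \<nu> \<phi>"
    using radon_measure_eqI[OF lc *(1,2)] *(3) by blast
  obtain U V where UV: "open U" "open V" "integral\<^sup>L \<mu> \<phi> \<in> U" "integral\<^sup>L \<nu> \<phi> \<in> V" "U \<inter> V = {}"
    using hausdorff[OF \<phi>(2)] by blast
  have op: "openin vague_topology {\<rho> \<in> radon_measures. integral\<^sup>L \<rho> \<phi> \<in> W}" if "open W" for W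
    unfolding vague_topology_def using \<phi>(1) that by (intro topology_generated_by_Basis) blast
  show "\<exists>U V. openin vague_topology U \<and> openin vague_topology V \<and> \<mu> \<in> U \<and> \<nu> \<in> V \<and> disjnt U V"
    using op[OF UV(1)] op[OF UV(2)] UV(3-5) *
    by (intro exI[of _ "{\<rho> \<in> radon_measures. integral\<^sup>L \<rho> \<phi> \<in> U}"]
        exI[of _ "{\<rho> \<in> radon_measures. integral\<^sup>L \<rho> \<phi> \<in> V}"]) (auto simp: disjnt_def)
qed

section \<open>Dirac combs of locally finite sets\<close>

definition locally_finite :: "'a::topological_space set \<Rightarrow> bool" where
  "locally_finite D \<longleftrightarrow> (\<forall>C. compact C \<longrightarrow> finite (D \<inter> C))"

lemma locally_finite_subset: "locally_finite D \<Longrightarrow> M \<subseteq> D \<Longrightarrow> locally_finite M"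
  unfolding locally_finite_def by (meson Int_mono finite_subset order_refl)

text \<open>The comb counts points, and finite sets are compact; so its value on any Borel set is already
approximated by finite subsets, also where it is infinite.\<close>

lemma dirac_comb_in_radon_measures:
  fixes M :: "'a::t2_space set"
  assumes "locally_finite M"
  shows "dirac_comb M \<in> radon_measures"
proof -
  have em: "emeasure (dirac_comb M) A = emeasure (count_space M) (A \<inter> M)" if "A \<in> sets borel" for A
    unfolding dirac_comb_def using that by (subst emeasure_distr) auto
  have comp: "C \<in> sets borel" if "compact C" for C :: "'a set"
    using that by (simp add: borel_closed compact_imp_closed)
  have emc: "emeasure (dirac_comb M) C = of_nat (card (C \<inter> M))" if "compact C" for C
    using that assms by (simp add: em comp locally_finite_def emeasure_count_space_finite Int_commute)
  have inner: "emeasure (dirac_comb M) A = (SUP K\<in>{K. compact K \<and> K \<subseteq> A}. emeasure (dirac_comb M) K)"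
    if A: "A \<in> sets borel" for A
  proof (rule antisym)
    show "(SUP K\<in>{K. compact K \<and> K \<subseteq> A}. emeasure (dirac_comb M) K) \<le> emeasure (dirac_comb M) A"
      using A by (intro SUP_least emeasure_mono) (auto simp: dirac_comb_def)
    have ge: "of_nat (card F) \<le> (SUP K\<in>{K. compact K \<and> K \<subseteq> A}. emeasure (dirac_comb M) K)"
      if "finite F" "F \<subseteq> A \<inter> M" for F
    proof -
      have "of_nat (card F) = emeasure (dirac_comb M) F"
        using that by (simp add: emc finite_imp_compact Int_absorb2)
      also have "\<dots> \<le> (SUP K\<in>{K. compact K \<and> K \<subseteq> A}. emeasure (dirac_comb M) K)"
        using that by (intro SUP_upper) (auto intro: finite_imp_compact)
      finally show ?thesis .
    qed
    show "emeasure (dirac_comb M) A \<le> (SUP K\<in>{K. compact K \<and> K \<subseteq> A}. emeasure (dirac_comb M) K)"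
    proof (cases "finite (A \<inter> M)")
      case True
      then show ?thesis using ge[of "A \<inter> M"] by (simp add: em[OF A])
    next
      case False
      have "of_nat n \<le> (SUP K\<in>{K. compact K \<and> K \<subseteq> A}. emeasure (dirac_comb M) K)" for n
      proof -
        obtain F where "finite F" "card F = n" "F \<subseteq> A \<inter> M"
          using infinite_arbitrarily_large[OF False, of n] by blast
        with ge show ?thesis by blast
      qed
      then have "(SUP n. of_nat n) \<le> (SUP K\<in>{K. compact K \<and> K \<subseteq> A}. emeasure (dirac_comb M) K)"
        by (rule SUP_least)
      then have "(SUP K\<in>{K. compact K \<and> K \<subseteq> A}. emeasure (dirac_comb M) K) = top"
        by (simp only: ennreal_SUP_of_nat_eq_top top_unique)
      then show ?thesis by (simp only: top_greatest)
    qed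
  qed
  show ?thesis
    unfolding radon_measures_def mem_Collect_eq
  proof (intro conjI allI impI ballI inner)
    show "sets (dirac_comb M) = sets borel" by (simp add: dirac_comb_def)
    show "emeasure (dirac_comb M) K < \<infinity>" if "compact K" for K
      by (simp add: emc[OF that] of_nat_less_top)
  qed
qed

lemma finite_support_on_locally_finite:
  assumes "locally_finite M" "\<phi> \<in> Cc"
  shows "finite {x \<in> M. \<phi> x \<noteq> 0}"
proof -
  have "finite (M \<inter> closure {x. \<phi> x \<noteq> 0})" using assms by (simp add: locally_finite_def Cc_def)
  then show ?thesis
    by (rule finite_subset[rotated]) (use closure_subset[of "{x. \<phi> x \<noteq> 0}"] in auto)
qed

lemma integral_dirac_comb:
  assumes "locally_finite M" "\<phi> \<in> Cc"
  shows "integral\<^sup>L (dirac_comb M) \<phi> = (\<Sum>x | x \<in> M \<and> \<phi> x \<noteq> 0. \<phi> x)"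
proof -
  have "\<phi> \<in> borel_measurable borel"
    using assms(2) by (intro borel_measurable_continuous_onI) (simp add: Cc_def)
  then have "integral\<^sup>L (dirac_comb M) \<phi> = (\<integral>x. \<phi> x \<partial>count_space M)"
    unfolding dirac_comb_def by (subst integral_distr) auto
  then show ?thesis
    using lebesgue_integral_count_space_finite_support[OF finite_support_on_locally_finite[OF assms]] by simp
qed

section \<open>Locally finite sets in a topological group\<close>

lemma locally_finite_translate:
  fixes M :: "'a::topological_ab_group_add set"
  assumes "locally_finite M"
  shows "locally_finite ((+) t ` M)"
  unfolding locally_finite_def
proof (intro allI impI)
  fix C :: "'a set" assume "compact C"
  then have "compact ((+) (- t) ` C)" by (intro compact_continuous_image continuous_intros)
  then have "finite (M \<inter> (+) (- t) ` C)" using assms by (simp add: locally_finite_def)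
  moreover have "(+) t ` M \<inter> C \<subseteq> (+) t ` (M \<inter> (+) (- t) ` C)"
  proof
    fix x assume x: "x \<in> (+) t ` M \<inter> C"
    then obtain m where m: "m \<in> M" "x = t + m" by auto
    then have "m = - t + x" by simp
    then have "m \<in> M \<inter> (+) (- t) ` C" using m x by blast
    then show "x \<in> (+) t ` (M \<inter> (+) (- t) ` C)" using m(2) by blast
  qed
  ultimately show "finite ((+) t ` M \<inter> C)" by (meson finite_imageI finite_subset)
qed

lemma compact_differences:
  fixes A B :: "'a::topological_ab_group_add set"
  assumes "compact A" "compact B"
  shows "compact {a - b |a b. a \<in> A \<and> b \<in> B}"
proof -
  have "compact ((\<lambda>p. fst p - snd p) ` (A \<times> B))"
    using assms by (intro compact_continuous_image compact_Times continuous_intros)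
  moreover have "(\<lambda>p. fst p - snd p) ` (A \<times> B) = {a - b |a b. a \<in> A \<and> b \<in> B}" by force
  ultimately show ?thesis by simp
qed

text \<open>If \<open>x\<close> and \<open>y\<close> both lie in \<open>c - U\<close>, then \<open>c\<close> lies in \<open>x + U\<close> and in \<open>y + U\<close>. Hence each of the open
sets \<open>c - U\<close> contains at most one point of \<open>L\<close>, and finitely many of them cover a compact set.\<close>

lemma uniformly_discrete_imp_locally_finite:
  fixes L :: "'a::topological_ab_group_add set"
  assumes "uniformly_discrete L"
  shows "locally_finite L"
  unfolding locally_finite_def
proof (intro allI impI)
  obtain U where U: "open U" "0 \<in> U"
    "\<And>x y. x \<in> L \<Longrightarrow> y \<in> L \<Longrightarrow> x \<noteq> y \<Longrightarrow> (+) x ` U \<inter> (+) y ` U = {}"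
    using assms unfolding uniformly_discrete_def by blast
  define N where "N c = {z. c - z \<in> U}" for c
  have opN: "open (N c)" for c
    using open_vimage[OF U(1), of "\<lambda>z. c - z"] by (simp add: N_def vimage_def continuous_intros)
  have single: "x = y" if "x \<in> L \<inter> N c" "y \<in> L \<inter> N c" for x y c
  proof (rule ccontr)
    assume "x \<noteq> y"
    moreover have "c \<in> (+) x ` U" "c \<in> (+) y ` U"
      using that by (auto simp: N_def intro: rev_image_eqI)
    ultimately show False using U(3)[of x y] that by blast
  qed
  have finN: "finite (L \<inter> N c)" for c
  proof (cases "L \<inter> N c = {}")
    case False
    then obtain x where "x \<in> L \<inter> N c" by blast
    with single have "L \<inter> N c \<subseteq> {x}" by blast
    then show ?thesis by (rule finite_subset) simp
  qed simp
  fix C :: "'a set" assume "compact C"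
  then obtain F where F: "F \<subseteq> C" "finite F" "C \<subseteq> (\<Union>c\<in>F. N c)"
  proof (rule compactE_image[of C C N])
    show "C \<subseteq> (\<Union>c\<in>C. N c)" using U(2) by (auto simp: N_def)
  qed (use opN in auto)
  then have "L \<inter> C \<subseteq> (\<Union>c\<in>F. L \<inter> N c)" by blast
  then show "finite (L \<inter> C)" using finN F(2) by (meson finite_UN finite_subset)
qed

definition differences :: "'a::minus set \<Rightarrow> 'a set" where
  "differences L = {x - y |x y. x \<in> L \<and> y \<in> L}"

text \<open>The difference set is the union of the sets \<open>-x + L\<close> over \<open>x \<in> L\<close>. Finite local complexity says that
only finitely many finite patterns occur among their intersections with \<open>C\<close>. This is the only form
in which finite local complexity enters below.\<close>

lemma differences_locally_finite:
  fixes L :: "'a::topological_ab_group_add set"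
  assumes "locally_finite L" "finite_local_complexity L"
  shows "locally_finite (differences L)"
  unfolding locally_finite_def
proof (intro allI impI)
  fix C :: "'a set" assume C: "compact C"
  define \<P> where "\<P> = {((+) (- x) ` L) \<inter> C |x. x \<in> L}"
  have "finite \<P>" using assms(2) C by (simp add: finite_local_complexity_def \<P>_def)
  moreover have "finite P" if "P \<in> \<P>" for P
  proof -
    from that obtain x where "P = (+) (- x) ` L \<inter> C" unfolding \<P>_def by blast
    then show ?thesis
      using locally_finite_translate[OF assms(1), of "- x"] C unfolding locally_finite_def by blast
  qed
  moreover have "differences L \<inter> C \<subseteq> \<Union>\<P>"
  proof
    fix d assume d: "d \<in> differences L \<inter> C"
    then obtain x y where "x \<in> L" "y \<in> L" "d = x - y" by (auto simp: differences_def)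
    then have "d \<in> (+) (- y) ` L \<inter> C" using d by (auto simp: image_iff intro!: bexI[of _ x])
    then show "d \<in> \<Union>\<P>" using \<open>y \<in> L\<close> by (auto simp: \<P>_def)
  qed
  ultimately show "finite (differences L \<inter> C)" by (meson finite_Union finite_subset)
qed

section \<open>Compactness of the hull\<close>

lemma continuous_map_into_vague_topology:
  fixes h :: "'b \<Rightarrow> 'a::t2_space measure"
  assumes "\<And>x. x \<in> topspace T \<Longrightarrow> h x \<in> radon_measures"
    and "\<And>\<phi>. \<phi> \<in> Cc \<Longrightarrow> continuous_map T euclidean (\<lambda>x. integral\<^sup>L (h x) \<phi>)"
  shows "continuous_map T vague_topology h"
  unfolding vague_topology_def
proof (rule continuous_on_generated_topo)
  fix U :: "'a measure set" assume "U \<in> {{\<mu> \<in> radon_measures. integral\<^sup>L \<mu> \<phi> \<in> V} |\<phi> V. \<phi> \<in> Cc \<and> open V}"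
  then obtain \<phi> V where U: "U = {\<mu> \<in> radon_measures. integral\<^sup>L \<mu> \<phi> \<in> V}" "\<phi> \<in> Cc" "open V" by blast
  have "openin T {x \<in> topspace T. integral\<^sup>L (h x) \<phi> \<in> V}"
    using assms(2)[OF U(2)] U(3) by (intro openin_continuous_map_preimage[of T euclidean]) auto
  moreover have "h -` U \<inter> topspace T = {x \<in> topspace T. integral\<^sup>L (h x) \<phi> \<in> V}"
    using assms(1) by (auto simp: U(1))
  ultimately show "openin T (h -` U \<inter> topspace T)" by simp
next
  show "h ` topspace T \<subseteq> \<Union>{{\<mu> \<in> radon_measures. integral\<^sup>L \<mu> \<phi> \<in> V} |\<phi> V. \<phi> \<in> Cc \<and> open V}"
    using assms(1) topspace_vague_topology unfolding vague_topology_def topology_generated_by_topspace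
    by blast
qed

text \<open>Only the points of \<open>D\<close> that some translation by an element of \<open>C\<close> moves into the support of \<open>\<phi>\<close>
contribute, so one finite sum serves for all \<open>k \<in> C\<close> and all \<open>M \<subseteq> D\<close> simultaneously.\<close>

lemma integral_translated_comb:
  fixes D :: "'a::{topological_ab_group_add, t2_space} set"
  assumes D: "locally_finite D" and "M \<subseteq> D" and \<phi>: "\<phi> \<in> Cc" and "k \<in> C"
    and F: "F = D \<inter> {s - c |s c. s \<in> closure {x. \<phi> x \<noteq> 0} \<and> c \<in> C}" and "finite F"
  shows "integral\<^sup>L (dirac_comb ((+) k ` M)) \<phi> = (\<Sum>d\<in>F. of_bool (d \<in> M) * \<phi> (k + d))"
proof -
  have "locally_finite ((+) k ` M)"
    by (rule locally_finite_translate[OF locally_finite_subset[OF D \<open>M \<subseteq> D\<close>]])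
  then have "integral\<^sup>L (dirac_comb ((+) k ` M)) \<phi> = (\<Sum>x | x \<in> (+) k ` M \<and> \<phi> x \<noteq> 0. \<phi> x)"
    using \<phi> by (rule integral_dirac_comb)
  also have "\<dots> = (\<Sum>d | d \<in> M \<and> \<phi> (k + d) \<noteq> 0. \<phi> (k + d))"
    by (rule sum.reindex_cong[of "(+) k"]) (auto simp: inj_on_def)
  also have "\<dots> = (\<Sum>d\<in>F. of_bool (d \<in> M) * \<phi> (k + d))"
  proof (rule sum.mono_neutral_cong_left)
    show "{d \<in> M. \<phi> (k + d) \<noteq> 0} \<subseteq> F"
    proof
      fix d assume d: "d \<in> {d \<in> M. \<phi> (k + d) \<noteq> 0}"
      then have "k + d \<in> closure {x. \<phi> x \<noteq> 0}" using closure_subset[of "{x. \<phi> x \<noteq> 0}"] by auto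
      moreover have "d = (k + d) - k" by simp
      ultimately show "d \<in> F" using d \<open>M \<subseteq> D\<close> \<open>k \<in> C\<close> unfolding F by blast
    qed
  qed (use \<open>finite F\<close> in auto)
  finally show ?thesis .
qed

text \<open>Subsets of \<open>D\<close> are points of the Cantor space of functions from \<open>D\<close> to the two-element discrete
space. The integral of a test function depends on finitely many coordinates of such a point, and
continuously on the translation.\<close>

lemma continuous_map_translated_comb:
  fixes D :: "'a::{topological_ab_group_add, t2_space} set"
  assumes D: "locally_finite D" and C: "compact C"
  shows "continuous_map
     (prod_topology (top_of_set C) (product_topology (\<lambda>_. discrete_topology (UNIV :: bool set)) D))
     vague_topology (\<lambda>(k, f). dirac_comb ((+) k ` {d \<in> D. f d}))" (is "continuous_map ?T _ ?h")
proof (rule continuous_map_into_vague_topology)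
  have sub: "{d \<in> D. f d} \<subseteq> D" for f by blast
  show "?h p \<in> radon_measures" for p
    using locally_finite_translate[OF locally_finite_subset[OF D sub]]
    by (auto intro!: dirac_comb_in_radon_measures split: prod.split)
  fix \<phi> :: "'a \<Rightarrow> complex" assume \<phi>: "\<phi> \<in> Cc"
  then have cont: "continuous_on UNIV \<phi>" by (simp add: Cc_def)
  define F where "F = D \<inter> {s - c |s c. s \<in> closure {x. \<phi> x \<noteq> 0} \<and> c \<in> C}"
  have F: "finite F" "F \<subseteq> D"
    using D \<phi> C compact_differences[of "closure {x. \<phi> x \<noteq> 0}" C]
    by (auto simp: F_def locally_finite_def Cc_def)
  have int: "integral\<^sup>L (?h p) \<phi> = (\<Sum>d\<in>F. of_bool (snd p d) * \<phi> (fst p + d))" if "p \<in> topspace ?T" for p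
  proof -
    have "fst p \<in> C" using that by auto
    from integral_translated_comb[OF D sub \<phi> this F_def F(1), of "snd p"]
    have "integral\<^sup>L (?h p) \<phi> = (\<Sum>d\<in>F. of_bool (d \<in> {d \<in> D. snd p d}) * \<phi> (fst p + d))"
      by (simp add: case_prod_beta)
    also have "\<dots> = (\<Sum>d\<in>F. of_bool (snd p d) * \<phi> (fst p + d))"
      using F(2) by (intro sum.cong) auto
    finally show ?thesis .
  qed
  have "continuous_map ?T euclidean (\<lambda>p. of_bool (snd p d) * \<phi> (fst p + d))" if d: "d \<in> F" for d
  proof -
    have "continuous_map ?T (discrete_topology UNIV) (\<lambda>p. snd p d)"
      using F(2) d by (intro continuous_map_compose[OF continuous_map_snd, unfolded o_def]
        continuous_map_product_projection[of d D "\<lambda>_. discrete_topology UNIV"]) auto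
    then have 1: "continuous_map ?T euclidean (\<lambda>p. of_bool (snd p d) :: complex)"
      by (rule continuous_map_compose[unfolded o_def]) simp
    have "continuous_on C (\<lambda>k. \<phi> (k + d))"
      by (rule continuous_on_compose2[OF cont]) (auto intro: continuous_intros)
    then have 2: "continuous_map ?T euclidean (\<lambda>p. \<phi> (fst p + d))"
      by (intro continuous_map_compose[OF continuous_map_fst, unfolded o_def]) simp
    from 1 2 show ?thesis by (simp add: continuous_map_atin tendsto_mult)
  qed
  then have "continuous_map ?T euclidean (\<lambda>p. \<Sum>d\<in>F. of_bool (snd p d) * \<phi> (fst p + d))"
    using F(1) by (intro continuous_map_sum) auto
  then show "continuous_map ?T euclidean (\<lambda>p. integral\<^sup>L (?h p) \<phi>)"
    by (rule continuous_map_eq) (rule int[symmetric])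
qed

text \<open>The preceding lemma with \<open>D = L\<close>, along the constant function that selects all of \<open>L\<close>.\<close>

lemma continuous_map_orbit:
  fixes L :: "'a::{topological_ab_group_add, t2_space} set"
  assumes "locally_finite L" "compact C"
  shows "continuous_map (top_of_set C) vague_topology (\<lambda>t. dirac_comb ((+) t ` L))"
proof -
  have "continuous_map (top_of_set C)
     (prod_topology (top_of_set C) (product_topology (\<lambda>_. discrete_topology (UNIV :: bool set)) L))
     (\<lambda>t. (t, restrict (\<lambda>_. True) L))"
    by (intro continuous_map_pairedI) (auto simp: continuous_map_const topspace_product_topology)
  from continuous_map_compose[OF this continuous_map_translated_comb[OF assms]]
  show ?thesis by (simp add: o_def cong: conj_cong)
qed

lemma topspace_hull_space:
  "topspace (hull_space L) = vague_topology closure_of {dirac_comb ((+) t ` L) |t. True}"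
  unfolding hull_space_def topspace_subtopology
  using closure_of_subset_topspace[of vague_topology] by blast

lemma orbit_in_hull:
  fixes L :: "'a::{topological_ab_group_add, t2_space} set"
  assumes "locally_finite L"
  shows "dirac_comb ((+) t ` L) \<in> topspace (hull_space L)"
proof -
  have "{dirac_comb ((+) t ` L) |t. True} \<subseteq> topspace vague_topology"
    using locally_finite_translate[OF assms] dirac_comb_in_radon_measures
    by (auto simp: topspace_vague_topology)
  then show ?thesis
    unfolding topspace_hull_space using closure_of_subset by blast
qed

lemma hull_subset_compact:
  fixes L :: "'a::{topological_ab_group_add, t2_space} set"
  assumes lc: "locally_compact_space (euclidean :: 'a topology)"
    and Y: "compactin vague_topology Y" and "\<And>t. dirac_comb ((+) t ` L) \<in> Y"
  shows "topspace (hull_space L) \<subseteq> Y" and "compact_space (hull_space L)"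
proof -
  have "closedin vague_topology Y"
    using Hausdorff_vague_topology[OF lc] Y by (rule compactin_imp_closedin)
  then show 1: "topspace (hull_space L) \<subseteq> Y"
    unfolding topspace_hull_space using assms(3) by (intro closure_of_minimal) auto
  then have "vague_topology closure_of {dirac_comb ((+) t ` L) |t. True} \<subseteq> Y"
    unfolding topspace_hull_space .
  from closed_compactin[OF Y this closedin_closure_of] show "compact_space (hull_space L)"
    unfolding hull_space_def by (rule compact_space_subtopology)
qed

text \<open>By relative density every translate \<open>t + L\<close> has a point \<open>c\<close> in a fixed compact set \<open>C\<close>, and then
\<open>t + L = c + M\<close> with \<open>M\<close> contained in the difference set of \<open>L\<close>. The orbit is thus contained in the
continuous image of \<open>C\<close> times the Cantor space over the difference set, which is compact by
Tychonoff's theorem.\<close>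

lemma compact_hull_space:
  fixes L :: "'a::{topological_ab_group_add, t2_space} set"
  assumes lc: "locally_compact_space (euclidean :: 'a topology)"
    and D: "locally_finite (differences L)" and dense: "relatively_dense L"
  shows "compact_space (hull_space L)"
proof -
  let ?D = "differences L"
  obtain K where K: "compact K" "{a + k |a k. a \<in> L \<and> k \<in> K} = UNIV"
    using dense unfolding relatively_dense_def by blast
  define C where "C = uminus ` K"
  have C: "compact C" unfolding C_def using K(1) by (intro compact_continuous_image continuous_intros)
  let ?Q = "product_topology (\<lambda>_. discrete_topology (UNIV :: bool set)) ?D"
  let ?T = "prod_topology (top_of_set C) ?Q"
  let ?h = "\<lambda>(k, f). dirac_comb ((+) k ` {d \<in> ?D. f d})"
  have "compact_space (top_of_set C)" using C by (simp add: compact_space_subtopology)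
  moreover have "compact_space ?Q"
    by (simp add: compact_space_product_topology compact_space_discrete_topology)
  ultimately have "compactin ?T (topspace ?T)"
    by (simp only: compact_space_def[symmetric] compact_space_prod_topology) simp
  then have Y: "compactin vague_topology (?h ` topspace ?T)"
    using continuous_map_translated_comb[OF D C] by (rule image_compactin)
  moreover have "dirac_comb ((+) t ` L) \<in> ?h ` topspace ?T" for t
  proof -
    have "- t \<in> {a + k |a k. a \<in> L \<and> k \<in> K}" using K(2) by simp
    then obtain x k where x: "x \<in> L" "k \<in> K" "- t = x + k" by blast
    \<comment> \<open>The translate \<open>t + L\<close> is viewed from its point \<open>c = t + x\<close>, which lies in \<open>C\<close>.\<close>
    define c where "c = t + x"
    have "t = - (x + k)" using x(3) by (metis minus_minus)
    then have "c = - k" by (simp add: c_def)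
    then have "c \<in> C" using x(2) by (simp add: C_def)
    define f where "f = restrict (\<lambda>d. x + d \<in> L) ?D"
    have "(+) t ` L = (+) c ` {d \<in> ?D. f d}"
    proof -
      have "l \<in> (+) x ` {d \<in> ?D. f d}" if "l \<in> L" for l
      proof -
        have "l - x \<in> ?D" using that x(1) by (auto simp: differences_def)
        then have "l - x \<in> {d \<in> ?D. f d}" using that by (simp add: f_def)
        then show ?thesis by (rule rev_image_eqI) simp
      qed
      then have "L = (+) x ` {d \<in> ?D. f d}" by (auto simp: f_def)
      then have "(+) t ` L = (+) t ` (+) x ` {d \<in> ?D. f d}" by simp
      then show ?thesis by (simp add: image_image c_def add.assoc)
    qed
    moreover have "(c, f) \<in> topspace ?T" using \<open>c \<in> C\<close> by (simp add: f_def topspace_product_topology)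
    ultimately show ?thesis by (intro image_eqI[of _ _ "(c, f)"]) simp_all
  qed
  ultimately show ?thesis by (rule hull_subset_compact(2)[OF lc])
qed

section \<open>Completely periodic sets have equicontinuous hulls\<close>

lemma translate_measure_orbit:
  "translate_measure s (dirac_comb ((+) t ` L)) = dirac_comb ((+) (s + t) ` L)"
  by (simp add: translate_measure_dirac_comb image_image add.assoc)

lemma compatible_uniformity_hull:
  assumes "locally_finite L"
  shows "compatible_uniformity (hull_space L) (vague_uniformity (topspace (hull_space L)))"
proof -
  have "topspace (hull_space L) \<subseteq> radon_measures"
    unfolding topspace_hull_space topspace_vague_topology[symmetric] by (rule closure_of_subset_topspace)
  from compatible_vague_uniformity[OF this] show ?thesis
    unfolding topspace_hull_space by (simp add: hull_space_def)
qed

text \<open>The entourages are the relations \<open>{(\<mu>, n + \<mu>). n \<in> N}\<close> for neighbourhoods \<open>N\<close> of \<open>0\<close>. Since the group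
is abelian they are invariant under translation. When \<open>X\<close> is the orbit of a completely periodic
set, this is the quotient uniformity of the group modulo its periods.\<close>

definition translation_uniformity :: "'a::topological_ab_group_add measure set \<Rightarrow> ('a measure \<times> 'a measure) filter" where
  "translation_uniformity X = filtermap (\<lambda>(n, \<mu>). (\<mu>, translate_measure n \<mu>)) (nhds 0 \<times>\<^sub>F principal X)"

lemma eventually_translation_uniformity:
  "eventually E (translation_uniformity X) \<longleftrightarrow>
     (\<forall>\<^sub>F n in nhds 0. \<forall>\<mu>\<in>X. E (\<mu>, translate_measure n \<mu>))" (is "?l \<longleftrightarrow> ?r")
proof
  assume ?l
  then obtain P Q where PQ: "eventually P (nhds 0)" "eventually Q (principal X)"
    "\<And>n \<mu>. P n \<Longrightarrow> Q \<mu> \<Longrightarrow> E (\<mu>, translate_measure n \<mu>)"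
    unfolding translation_uniformity_def eventually_filtermap eventually_prod_filter by auto
  then show ?r by (auto simp: eventually_principal elim!: eventually_mono)
next
  assume ?r
  then show ?l
    unfolding translation_uniformity_def eventually_filtermap eventually_prod_filter
    by (intro exI[of _ "\<lambda>n. \<forall>\<mu>\<in>X. E (\<mu>, translate_measure n \<mu>)"] exI[of _ "\<lambda>\<mu>. \<mu> \<in> X"])
       (auto simp: eventually_principal)
qed

lemma eventually_orbit_in_open:
  fixes L :: "'a::{topological_ab_group_add, t2_space} set"
  assumes lc: "locally_compact_space (euclidean :: 'a topology)" and L: "locally_finite L"
    and T: "openin vague_topology T" "dirac_comb ((+) t ` L) \<in> T"
  shows "\<forall>\<^sub>F n in nhds 0. dirac_comb ((+) (n + t) ` L) \<in> T"
proof -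
  obtain U C where UC: "open U" "compact C" "{t} \<subseteq> U" "U \<subseteq> C"
    using locally_compact_neighbourhood[OF lc, of "{t}"] by auto
  have "openin (top_of_set C) {x \<in> topspace (top_of_set C). dirac_comb ((+) x ` L) \<in> T}"
    using continuous_map_orbit[OF L UC(2)] T(1) by (rule openin_continuous_map_preimage)
  then obtain W where W: "open W" "{x \<in> C. dirac_comb ((+) x ` L) \<in> T} = C \<inter> W"
    unfolding openin_open by auto
  have "t \<in> U \<inter> W" using UC(3,4) W(2) T(2) by auto
  moreover have "((\<lambda>n. n + t) \<longlongrightarrow> 0 + t) (nhds 0)" by (intro tendsto_intros filterlim_ident)
  ultimately have "\<forall>\<^sub>F n in nhds 0. n + t \<in> U \<inter> W"
    using UC(1) W(1) by (auto dest: topological_tendstoD[of _ _ _ "U \<inter> W"])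
  then show ?thesis by (rule eventually_mono) (use UC(4) W(2) in auto)
qed

text \<open>Modulo periods every translation lies in the compact set \<open>C\<close>. So the orbit is already compact, hence
closed, and the hull has no further points.\<close>

lemma hull_of_completely_periodic:
  fixes L :: "'a::{topological_ab_group_add, t2_space} set"
  assumes lc: "locally_compact_space (euclidean :: 'a topology)" and L: "locally_finite L"
    and per: "completely_periodic L"
  obtains C where "compact C" "topspace (hull_space L) = (\<lambda>t. dirac_comb ((+) t ` L)) ` C"
    "topspace (hull_space L) = range (\<lambda>t. dirac_comb ((+) t ` L))" "compact_space (hull_space L)"
proof -
  obtain C where C: "compact C" "{p + c |p c. p \<in> periods L \<and> c \<in> C} = UNIV"
    using per unfolding completely_periodic_def relatively_dense_def by blast
  let ?Y = "(\<lambda>t. dirac_comb ((+) t ` L)) ` C"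
  have Y: "compactin vague_topology ?Y"
    using image_compactin[OF _ continuous_map_orbit[OF L C(1)], of C] C(1)
    by (simp add: compactin_subtopology)
  have orbit: "dirac_comb ((+) t ` L) \<in> ?Y" for t
  proof -
    have "t \<in> {p + c |p c. p \<in> periods L \<and> c \<in> C}" using C(2) by simp
    then obtain p c where p: "(+) p ` L = L" "c \<in> C" "t = p + c" unfolding periods_def by blast
    have "(+) t ` L = (+) c ` (+) p ` L" unfolding image_image p(3) by (simp add: ac_simps)
    then have "(+) t ` L = (+) c ` L" using p(1) by simp
    then show ?thesis using p(2) by simp
  qed
  have "range (\<lambda>t. dirac_comb ((+) t ` L)) \<subseteq> topspace (hull_space L)"
    using orbit_in_hull[OF L] by auto
  moreover note hull_subset_compact[OF lc Y orbit]
  ultimately show ?thesis using C(1) by (intro that[of C]) auto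
qed

text \<open>The orbit map from \<open>C\<close> onto the hull is continuous from a compact to a Hausdorff space, hence a
quotient map. So openness in the hull can be tested in the group, where small translations form the
neighbourhoods. The other axioms are those of neighbourhoods of \<open>0\<close> in a topological group.\<close>

lemma compatible_translation_uniformity:
  fixes L :: "'a::{topological_ab_group_add, t2_space} set"
  assumes lc: "locally_compact_space (euclidean :: 'a topology)" and L: "locally_finite L"
    and per: "completely_periodic L"
  shows "compatible_uniformity (hull_space L) (translation_uniformity (topspace (hull_space L)))"
proof -
  define \<pi> where "\<pi> = (\<lambda>t. dirac_comb ((+) t ` L))"
  obtain C where C: "compact C" "topspace (hull_space L) = \<pi> ` C"
    and X: "topspace (hull_space L) = range \<pi>"
    unfolding \<pi>_def using hull_of_completely_periodic[OF lc L per] by metis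
  have tr: "translate_measure s (\<pi> t) = \<pi> (s + t)" for s t
    unfolding \<pi>_def by (rule translate_measure_orbit)
  have ev: "eventually E (translation_uniformity (range \<pi>)) \<longleftrightarrow> (\<forall>\<^sub>F n in nhds 0. \<forall>t. E (\<pi> t, \<pi> (n + t)))" for E
    unfolding eventually_translation_uniformity by (simp add: tr)
  have carrier: "translation_uniformity (range \<pi>) \<le> principal (range \<pi> \<times> range \<pi>)"
    unfolding le_principal ev by simp
  have refl: "E (x, x)" if "eventually E (translation_uniformity (range \<pi>))" "x \<in> range \<pi>" for E x
    using eventually_nhds_x_imp_x[OF that(1)[unfolded ev]] that(2) by auto
  have sym: "eventually (\<lambda>(x, y). E (y, x)) (translation_uniformity (range \<pi>))"
    if "eventually E (translation_uniformity (range \<pi>))" for E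
  proof -
    have "(uminus \<longlongrightarrow> (0::'a)) (nhds 0)" using tendsto_uminus_nhds[of "0::'a"] by simp
    from eventually_compose_filterlim[OF that[unfolded ev] this]
    have "\<forall>\<^sub>F n in nhds 0. \<forall>t. E (\<pi> t, \<pi> (- n + t))" .
    then have "\<forall>\<^sub>F n in nhds 0. \<forall>t. E (\<pi> (n + t), \<pi> t)"
    proof (rule eventually_mono, intro allI)
      fix n t assume "\<forall>t. E (\<pi> t, \<pi> (- n + t))"
      then have "E (\<pi> (n + t), \<pi> (- n + (n + t)))" by blast
      then show "E (\<pi> (n + t), \<pi> t)" by simp
    qed
    then show ?thesis unfolding ev by simp
  qed
  have half: "\<exists>D. eventually D (translation_uniformity (range \<pi>)) \<and> (\<forall>x y z. D (x, y) \<longrightarrow> D (y, z) \<longrightarrow> E (x, z))"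
    if E: "eventually E (translation_uniformity (range \<pi>))" for E
  proof -
    have "((\<lambda>p. fst p + snd p) \<longlongrightarrow> (0::'a)) (nhds 0 \<times>\<^sub>F nhds 0)"
      using tendsto_add_Pair[of "0::'a" 0] by simp
    from eventually_compose_filterlim[OF E[unfolded ev] this]
    obtain Q where Q: "eventually Q (nhds (0::'a))"
      "\<And>m n t. Q m \<Longrightarrow> Q n \<Longrightarrow> E (\<pi> t, \<pi> (m + n + t))"
      unfolding eventually_prod_same by auto
    define D where "D = (\<lambda>(x, y). \<exists>n t. Q n \<and> x = \<pi> t \<and> y = \<pi> (n + t))"
    have "eventually D (translation_uniformity (range \<pi>))"
      unfolding ev D_def using Q(1) by (auto elim!: eventually_mono)
    moreover have "E (x, z)" if xy: "D (x, y)" and yz: "D (y, z)" for x y z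
    proof -
      obtain n t where n: "Q n" "x = \<pi> t" "y = \<pi> (n + t)" using xy by (auto simp: D_def)
      obtain m s where m: "Q m" "y = \<pi> s" "z = \<pi> (m + s)" using yz by (auto simp: D_def)
      have "z = translate_measure m y" using m by (simp add: tr)
      then have "z = \<pi> (m + n + t)" using n(3) by (simp add: tr add.assoc)
      then show ?thesis using Q(2)[OF m(1) n(1)] n(2) by simp
    qed
    ultimately show ?thesis by blast
  qed
  have opn: "openin (hull_space L) S \<longleftrightarrow> S \<subseteq> range \<pi> \<and>
      (\<forall>x\<in>S. eventually (\<lambda>(x', y). x' = x \<longrightarrow> y \<in> S) (translation_uniformity (range \<pi>)))"
    (is "?l \<longleftrightarrow> ?r") for S
  proof
    assume ?l
    then obtain T where T: "openin vague_topology T" "S = T \<inter> topspace (hull_space L)"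
      unfolding hull_space_def openin_subtopology topspace_hull_space[unfolded hull_space_def] by blast
    have "eventually (\<lambda>(x', y). x' = x \<longrightarrow> y \<in> S) (translation_uniformity (range \<pi>))" if x: "x \<in> S" for x
    proof -
      obtain t where t: "x = \<pi> t" using x T(2) X by auto
      have "\<forall>\<^sub>F n in nhds 0. \<pi> (n + t) \<in> T"
        using eventually_orbit_in_open[OF lc L T(1), of t] x T(2) t by (simp add: \<pi>_def)
      then show ?thesis
        unfolding ev split
      proof (rule eventually_mono, intro allI impI)
        fix n s assume *: "\<pi> (n + t) \<in> T" "\<pi> s = x"
        then have "\<pi> (n + s) = \<pi> (n + t)" using t tr by metis
        with * show "\<pi> (n + s) \<in> S" unfolding T(2) X by simp
      qed
    qed
    with T(2) X show ?r by auto
  next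
    assume r: ?r
    have "quotient_map (top_of_set C) (hull_space L) \<pi>"
    proof (rule continuous_imp_quotient_map)
      show "continuous_map (top_of_set C) (hull_space L) \<pi>"
        unfolding hull_space_def
        using continuous_map_orbit[OF L C(1)] C(2)
        by (intro continuous_map_into_subtopology) (auto simp: \<pi>_def topspace_hull_space)
      show "Hausdorff_space (hull_space L)"
        unfolding hull_space_def by (intro Hausdorff_space_subtopology Hausdorff_vague_topology lc)
    qed (use C in \<open>simp_all add: compact_space_subtopology\<close>)
    moreover have "openin (top_of_set C) {c \<in> C. \<pi> c \<in> S}"
    proof -
      have "open {t. \<pi> t \<in> S}"
      proof (subst open_subopen, intro ballI)
        fix t assume "t \<in> {t. \<pi> t \<in> S}"
        then have "\<forall>\<^sub>F n in nhds 0. \<forall>s. \<pi> s = \<pi> t \<longrightarrow> \<pi> (n + s) \<in> S"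
          using r unfolding ev split by simp
        then obtain N where N: "open N" "0 \<in> N" "\<And>n. n \<in> N \<Longrightarrow> \<pi> (n + t) \<in> S"
          unfolding eventually_nhds by blast
        have "open {x. x - t \<in> N}"
          using open_vimage[OF N(1), of "\<lambda>x. x - t"] by (simp add: vimage_def continuous_intros)
        moreover have "{x. x - t \<in> N} \<subseteq> {t. \<pi> t \<in> S}"
        proof
          fix x assume "x \<in> {x. x - t \<in> N}"
          then show "x \<in> {t. \<pi> t \<in> S}" using N(3)[of "x - t"] by simp
        qed
        ultimately show "\<exists>T. open T \<and> t \<in> T \<and> T \<subseteq> {t. \<pi> t \<in> S}"
          using N(2) by (intro exI[of _ "{x. x - t \<in> N}"]) simp
      qed
      then show ?thesis by (auto simp: openin_open intro!: exI[of _ "{t. \<pi> t \<in> S}"])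
    qed
    ultimately show ?l using r X unfolding quotient_map_def by simp
  qed
  show ?thesis
    unfolding compatible_uniformity_def X
    using carrier refl sym half opn by (intro conjI allI impI ballI) simp_all
qed

text \<open>An entourage of the translation uniformity contains an invariant one: if \<open>y = n + x\<close>, then
\<open>s + y = n + (s + x)\<close> with the same small \<open>n\<close>.\<close>

lemma completely_periodic_imp_equicontinuous:
  fixes L :: "'a::{topological_ab_group_add, t2_space} set"
  assumes lc: "locally_compact_space (euclidean :: 'a topology)" and L: "locally_finite L"
    and per: "completely_periodic L"
  shows "equicontinuous_system (hull_space L) translate_measure"
proof -
  define \<pi> where "\<pi> = (\<lambda>t. dirac_comb ((+) t ` L))"
  have X: "topspace (hull_space L) = range \<pi>" and cpt: "compact_space (hull_space L)"
    unfolding \<pi>_def using hull_of_completely_periodic[OF lc L per] by metis+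
  have tr: "translate_measure s (\<pi> t) = \<pi> (s + t)" for s t
    unfolding \<pi>_def by (rule translate_measure_orbit)
  have U: "uniformity_of (hull_space L) = translation_uniformity (range \<pi>)"
    using uniformity_of_eqI[OF cpt compatible_translation_uniformity[OF lc L per]] X by simp
  have ev: "eventually E (translation_uniformity (range \<pi>)) \<longleftrightarrow> (\<forall>\<^sub>F n in nhds 0. \<forall>t. E (\<pi> t, \<pi> (n + t)))" for E
    unfolding eventually_translation_uniformity by (simp add: tr)
  show ?thesis
    unfolding equicontinuous_system_def U
  proof (intro allI impI)
    fix V assume V: "eventually V (translation_uniformity (range \<pi>))"
    define Q where "Q = (\<lambda>n. \<forall>t. V (\<pi> t, \<pi> (n + t)))"
    define E where "E = (\<lambda>(x, y). \<exists>n t. Q n \<and> x = \<pi> t \<and> y = \<pi> (n + t))"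
    have "eventually E (translation_uniformity (range \<pi>))"
      using V unfolding ev E_def Q_def by (auto elim!: eventually_mono)
    moreover have "V (translate_measure s x, translate_measure s y)" if xy: "E (x, y)" for x y s
    proof -
      obtain n t where n: "Q n" "x = \<pi> t" "y = \<pi> (n + t)" using xy by (auto simp: E_def)
      have "V (\<pi> (s + t), \<pi> (n + (s + t)))" using n(1) by (simp add: Q_def)
      then show ?thesis by (simp add: n tr ac_simps)
    qed
    ultimately show "\<exists>U. eventually U (translation_uniformity (range \<pi>)) \<and>
        (\<forall>x y. U (x, y) \<longrightarrow> (\<forall>t. V (translate_measure t x, translate_measure t y)))" by blast
  qed
qed

section \<open>Almost periods of sets with finite local complexity\<close>

lemma subtract_neighbourhood:
  fixes N :: "'a::topological_ab_group_add set"
  assumes "open N" "0 \<in> N"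
  obtains N' where "open N'" "0 \<in> N'" "\<And>m n. m \<in> N' \<Longrightarrow> n \<in> N' \<Longrightarrow> m - n \<in> N"
proof -
  have "((\<lambda>p. fst p - snd p) \<longlongrightarrow> 0 - (0::'a)) (nhds 0 \<times>\<^sub>F nhds 0)"
    by (intro tendsto_diff filterlim_fst filterlim_snd)
  from topological_tendstoD[OF this assms(1)] assms(2)
  obtain Q where Q: "eventually Q (nhds (0::'a))" "\<And>m n. Q m \<Longrightarrow> Q n \<Longrightarrow> m - n \<in> N"
    unfolding eventually_prod_same by auto
  from Q(1) obtain N' where N': "open N'" "0 \<in> N'" "\<forall>n\<in>N'. Q n"
    unfolding eventually_nhds by blast
  show ?thesis by (rule that[OF N'(1,2)]) (use Q(2) N'(3) in blast)
qed

text \<open>The test functions are bumps, each supported near its centre \<open>z\<close> and exceeding \<open>1/2\<close> on an open set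
around \<open>z\<close>; finitely many of these open sets cover \<open>C\<close>. A point of \<open>M\<close> in such an open set makes the
integral of the bump over \<open>M\<close> larger than \<open>1/2\<close>. The integral over \<open>M'\<close> is then positive, so \<open>M'\<close>
also has a point in the support of the bump.\<close>

lemma vague_close_imp_nearby_point:
  fixes C :: "'a::{topological_ab_group_add, t2_space} set"
  assumes lc: "locally_compact_space (euclidean :: 'a topology)"
    and C: "compact C" and N: "open N" "0 \<in> N"
  obtains \<Phi> :: "('a \<Rightarrow> complex) set" where "finite \<Phi>" "\<Phi> \<subseteq> Cc"
    "\<And>M M' x. locally_finite M \<Longrightarrow> locally_finite M' \<Longrightarrow>
       vague_close \<Phi> (1/2) (dirac_comb M) (dirac_comb M') \<Longrightarrow> x \<in> M \<inter> C \<Longrightarrow> \<exists>n\<in>N. x + n \<in> M'"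
proof -
  obtain N' where N': "open N'" "0 \<in> N'" "\<And>m n. m \<in> N' \<Longrightarrow> n \<in> N' \<Longrightarrow> m - n \<in> N"
    using subtract_neighbourhood[OF N] by blast
  have ex: "\<exists>g :: 'a \<Rightarrow> real. continuous_on UNIV g \<and> (\<forall>x. 0 \<le> g x) \<and> g z = 1 \<and>
      (\<forall>x. x - z \<notin> N' \<longrightarrow> g x = 0) \<and> compact (closure {x. g x \<noteq> 0})" for z
  proof -
    have 1: "open {x. x - z \<in> N'}"
      using open_vimage[OF N'(1), of "\<lambda>x. x - z"] by (simp add: vimage_def continuous_intros)
    have 2: "{z} \<subseteq> {x. x - z \<in> N'}" using N'(2) by simp
    show ?thesis
    proof (rule locally_compact_Urysohn[OF lc compact_sing 1 2], goal_cases)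
      case (1 g)
      then show ?case by (intro exI[of _ g]) simp
    qed
  qed
  obtain g :: "'a \<Rightarrow> 'a \<Rightarrow> real" where g0: "\<forall>z. continuous_on UNIV (g z) \<and> (\<forall>x. 0 \<le> g z x) \<and>
      g z z = 1 \<and> (\<forall>x. x - z \<notin> N' \<longrightarrow> g z x = 0) \<and> compact (closure {x. g z x \<noteq> 0})"
    using choice[OF allI[OF ex]] by (rule exE)
  then have g: "continuous_on UNIV (g z)" "0 \<le> g z x" "g z z = 1"
      "x - z \<notin> N' \<Longrightarrow> g z x = 0" "compact (closure {x. g z x \<noteq> 0})" for z x
    by simp_all
  define S where "S = (\<lambda>z. {x. g z x > 1/2})"
  have opS: "open (S z)" for z
    using open_Collect_less[OF continuous_on_const g(1)[of z], of "1/2"] by (simp add: S_def)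
  obtain F where F: "F \<subseteq> C" "finite F" "C \<subseteq> (\<Union>z\<in>F. S z)"
  proof (rule compactE_image[OF C, of C S])
    show "C \<subseteq> (\<Union>c\<in>C. S c)" using g(3) by (auto simp: S_def)
  qed (use opS in auto)
  define \<phi> where "\<phi> = (\<lambda>z x. complex_of_real (g z x))"
  have \<phi>: "\<phi> z \<in> Cc" for z unfolding \<phi>_def using g(1,5) by (rule of_real_in_Cc)
  show ?thesis
  proof (rule that[of "\<phi> ` F"])
    fix M M' x assume M: "locally_finite M" and M': "locally_finite M'"
      and close: "vague_close (\<phi> ` F) (1/2) (dirac_comb M) (dirac_comb M')" and x: "x \<in> M \<inter> C"
    obtain z where z: "z \<in> F" "g z x > 1/2" using F(3) x by (auto simp: S_def)
    have int: "integral\<^sup>L (dirac_comb M) (\<phi> z) = complex_of_real (\<Sum>x | x \<in> M \<and> g z x \<noteq> 0. g z x)"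
      if "locally_finite M" for M
      using integral_dirac_comb[OF that \<phi>[of z]] by (simp add: \<phi>_def)
    have "finite {x \<in> M. g z x \<noteq> 0}"
      using finite_support_on_locally_finite[OF M \<phi>[of z]] by (simp add: \<phi>_def)
    then have "g z x \<le> (\<Sum>x | x \<in> M \<and> g z x \<noteq> 0. g z x)"
      using x z(2) g(2) by (intro member_le_sum) auto
    moreover have "dist (integral\<^sup>L (dirac_comb M) (\<phi> z)) (integral\<^sup>L (dirac_comb M') (\<phi> z)) < 1/2"
      using close z(1) by (auto simp: vague_close_def)
    then have "dist (\<Sum>x | x \<in> M \<and> g z x \<noteq> 0. g z x) (\<Sum>x | x \<in> M' \<and> g z x \<noteq> 0. g z x) < 1/2"
      unfolding int[OF M] int[OF M'] dist_of_real .
    ultimately have "(\<Sum>x | x \<in> M' \<and> g z x \<noteq> 0. g z x) \<noteq> 0"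
      using z(2) by (auto simp: dist_real_def)
    then obtain y where "y \<in> M'" "g z y \<noteq> 0" by (metis (no_types, lifting) mem_Collect_eq sum.neutral)
    then have "y - z \<in> N'" "x - z \<in> N'" using g(4) z(2) by force+
    then have "y - x \<in> N" using N'(3)[of "y - z" "x - z"] by simp
    then show "\<exists>n\<in>N. x + n \<in> M'" using \<open>y \<in> M'\<close> by (intro bexI[of _ "y - x"]) simp
  qed (use F(2) \<phi> in auto)
qed

text \<open>This is where compact generation is used: any two points of the relatively dense set \<open>L\<close> are joined
by a chain in \<open>L\<close> with steps in \<open>K - K + W\<close> or \<open>K - K - W\<close>. A path of generators between the two
points need not stay in \<open>L\<close>, but each of its vertices is within \<open>K\<close> of a point of \<open>L\<close>.\<close>

lemma relatively_dense_chain_induct: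
  fixes L W K :: "'a::ab_group_add set"
  assumes gen: "group_closure W = UNIV" and dense: "{a + k |a k. a \<in> L \<and> k \<in> K} = UNIV"
    and step: "\<And>x y w k k'. x \<in> L \<Longrightarrow> y \<in> L \<Longrightarrow> P x \<Longrightarrow> w \<in> insert 0 W \<Longrightarrow> k \<in> K \<Longrightarrow> k' \<in> K \<Longrightarrow>
      y - x = k - k' + w \<or> y - x = k - k' - w \<Longrightarrow> P y"
    and start: "x0 \<in> L" "P x0" and "y \<in> L"
  shows "P y"
proof -
  have cover: "\<exists>x\<in>L. \<exists>k\<in>K. x + k = g" for g
  proof -
    have "g \<in> {a + k |a k. a \<in> L \<and> k \<in> K}" using dense by simp
    then show ?thesis by blast
  qed
  \<comment> \<open>The property is transported from \<open>L\<close> to the whole group: a vertex \<open>g\<close> is good if it holds at every point of \<open>L\<close> that \<open>K\<close> connects to \<open>g\<close>.\<close>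
  define good where "good = (\<lambda>g. \<forall>x\<in>L. \<forall>k\<in>K. x + k = g \<longrightarrow> P x)"
  have good_step: "good (g + w)" "good (g - w)" if g: "good g" and w: "w \<in> insert 0 W" for g w
  proof -
    obtain x' k' where x': "x' \<in> L" "k' \<in> K" "x' + k' = g" using cover by blast
    then have "P x'" using g by (auto simp: good_def)
    have "P x" if "x \<in> L" "k \<in> K" "x + k = g + w" for x k
    proof -
      have "x - x' = k' - k + w" using that(3) x'(3) by (simp add: algebra_simps)
      then show ?thesis using step[OF x'(1) that(1) \<open>P x'\<close> w x'(2) that(2)] by simp
    qed
    then show "good (g + w)" unfolding good_def by blast
    have "P x" if "x \<in> L" "k \<in> K" "x + k = g - w" for x k
    proof -
      have "x - x' = k' - k - w" using that(3) x'(3) by (simp add: algebra_simps)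
      then show ?thesis using step[OF x'(1) that(1) \<open>P x'\<close> w x'(2) that(2)] by simp
    qed
    then show "good (g - w)" unfolding good_def by blast
  qed
  \<comment> \<open>The elements that preserve goodness in both directions form a subgroup, which contains \<open>W\<close>.\<close>
  have inv: "good (g + h) \<longleftrightarrow> good g" if "h \<in> group_closure W" for g h
    using that
  proof (induction arbitrary: g rule: group_closure.induct)
    case (base s)
    then show ?case using good_step(1)[of g s] good_step(2)[of "g + s" s] by auto
  next
    case (diff s t)
    show ?case using diff.IH(1)[of g] diff.IH(2)[of "g + (s - t)"] by (simp add: algebra_simps)
  qed
  obtain x1 k1 where 1: "x1 \<in> L" "k1 \<in> K" "x1 + k1 = y" using cover by blast
  have "good (x0 + k1)"
    unfolding good_def
  proof (intro ballI impI)
    fix x k assume "x \<in> L" "k \<in> K" "x + k = x0 + k1"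
    moreover from this have "x - x0 = k1 - k + 0" by (simp add: algebra_simps)
    ultimately show "P x" using step[OF start(1) _ start(2), of x 0 k1 k] 1(2) by simp
  qed
  then have "good (y + k1)" using inv[of "y - x0" "x0 + k1"] gen by (simp add: algebra_simps)
  then show ?thesis using \<open>y \<in> L\<close> 1(2) by (simp add: good_def)
qed

text \<open>An almost period that is uniform over all translates is close to a true period. Here the hypothesis
on \<open>p\<close> says that \<open>s + p + L\<close> and \<open>s + L\<close> are vaguely close for every \<open>s\<close>. Taking \<open>s = -(p + x)\<close> shows
that \<open>p + x\<close> has a point \<open>p + x + n\<close> of \<open>L\<close> nearby. For a second point \<open>y \<in> L\<close> with \<open>y - x \<in> K\<close> the same
\<open>s\<close> gives a nearby point \<open>p + y + m\<close>. Now \<open>y - x\<close> and \<open>y - x + (m - n)\<close> are two differences of points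
of \<open>L\<close> in a compact set; as there are only finitely many, they coincide when \<open>m - n\<close> is small enough.
So the correction \<open>n\<close> does not change along chains with steps in \<open>K\<close>, and it is constant on \<open>L\<close>.\<close>

lemma exists_almost_period_test:
  fixes L :: "'a::{topological_ab_group_add, t2_space} set"
  assumes lc: "locally_compact_space (euclidean :: 'a topology)"
    and cg: "compactly_generated TYPE('a)"
    and L: "locally_finite L" and dense: "relatively_dense L"
    and D: "locally_finite (differences L)"
  obtains \<Phi> :: "('a \<Rightarrow> complex) set" and Q where "finite \<Phi>" "\<Phi> \<subseteq> Cc" "compact Q"
    "\<And>p. (\<And>s. vague_close \<Phi> (1/2) (dirac_comb ((+) (s + p) ` L)) (dirac_comb ((+) s ` L)))
       \<Longrightarrow> \<exists>n\<in>Q. p + n \<in> periods L"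
proof -
  obtain W :: "'a set" where W: "compact W" "0 \<in> interior W" "group_closure W = UNIV"
    using cg unfolding compactly_generated_def by blast
  obtain K' where K': "compact K'" "{a + k |a k. a \<in> L \<and> k \<in> K'} = UNIV"
    using dense unfolding relatively_dense_def by blast
  \<comment> \<open>The set \<open>K\<close> contains all steps of the chains. It also contains \<open>0\<close>, so that closeness on \<open>K\<close> sees the point at the origin of a translate.\<close>
  define W' where "W' = insert 0 W \<union> uminus ` insert 0 W"
  have W': "compact W'"
    unfolding W'_def using W(1)
    by (intro compact_Un compact_insert compact_continuous_image continuous_intros)
  define K where "K = insert 0 {a - b |a b. a \<in> {k - k' |k k'. k \<in> K' \<and> k' \<in> K'} \<and> b \<in> W'}"
  have K: "compact K"
    unfolding K_def using W' K'(1) by (intro compact_insert compact_differences)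
  obtain O0 Q :: "'a set" where Q: "open O0" "compact Q" "{0} \<subseteq> O0" "O0 \<subseteq> Q"
    using locally_compact_neighbourhood[OF lc, of "{0}"] by auto
  define K3 where "K3 = {a - b |a b. a \<in> K \<and> b \<in> uminus ` Q}"
  have K3: "compact K3"
    unfolding K3_def using K Q(2)
    by (intro compact_differences compact_continuous_image continuous_intros)
  have K3I: "f + q \<in> K3" if "f \<in> K" "q \<in> O0" for f q
  proof -
    have "f + q = f - (- q)" by simp
    then show ?thesis using that Q(4) unfolding K3_def by blast
  qed
  define F where "F = differences L \<inter> K3"
  have F: "finite F" using D K3 by (simp add: F_def locally_finite_def)
  \<comment> \<open>All nonzero differences between elements of the finite set \<open>F\<close> are removed from the neighbourhood.\<close>
  define N1 where "N1 = O0 - ({g - f |f g. f \<in> F \<and> g \<in> F} - {0})"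
  have "finite {g - f |f g. f \<in> F \<and> g \<in> F}"
    using finite_imageI[OF finite_cartesian_product[OF F F], of "\<lambda>(f, g). g - f"]
    by (rule finite_subset[rotated]) auto
  then have "open N1" unfolding N1_def using Q(1) by (intro open_Diff finite_imp_closed) auto
  moreover have "0 \<in> N1" using Q(3) by (simp add: N1_def)
  ultimately obtain N2 where N2: "open N2" "0 \<in> N2" "\<And>m n. m \<in> N2 \<Longrightarrow> n \<in> N2 \<Longrightarrow> m - n \<in> N1"
    using subtract_neighbourhood by blast
  \<comment> \<open>The neighbourhood is symmetric because the correction is read off once from \<open>p + L\<close> to \<open>L\<close> and once in the opposite direction.\<close>
  define N where "N = N2 \<inter> uminus -` N2 \<inter> O0"
  have N: "open N" "0 \<in> N"
    unfolding N_def using N2 Q(1,3) by (auto intro!: open_Int open_vimage continuous_intros)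
  have N1: "m - n \<in> N1" if "m \<in> N" "n \<in> N" for m n using that N2(3) by (simp add: N_def)
  have isolated: "d = 0" if "f \<in> differences L" "f \<in> K" "f + d \<in> differences L" "d \<in> N1" for f d
  proof -
    have "d \<in> O0" using that(4) by (simp add: N1_def)
    then have "f + d \<in> F" "f + 0 \<in> F" using that(1-3) K3I[of f d] K3I[of f 0] Q(3) unfolding F_def by auto
    then have "d \<in> {g - f |f g. f \<in> F \<and> g \<in> F}"
      by (intro CollectI exI[of _ f] exI[of _ "f + d"]) simp
    then show ?thesis using that(4) by (auto simp: N1_def)
  qed
  obtain \<Phi> :: "('a \<Rightarrow> complex) set" where \<Phi>: "finite \<Phi>" "\<Phi> \<subseteq> Cc"
    "\<And>M M' x. locally_finite M \<Longrightarrow> locally_finite M' \<Longrightarrow>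
       vague_close \<Phi> (1/2) (dirac_comb M) (dirac_comb M') \<Longrightarrow> x \<in> M \<inter> K \<Longrightarrow> \<exists>n\<in>N. x + n \<in> M'"
    using vague_close_imp_nearby_point[OF lc K N] by blast
  have shift: "d \<in> (+) (- a) ` L \<longleftrightarrow> a + d \<in> L" for a d
  proof
    show "a + d \<in> L \<Longrightarrow> d \<in> (+) (- a) ` L" by (rule rev_image_eqI[of "a + d"]) simp_all
  qed auto
  have "\<exists>n\<in>Q. p + n \<in> periods L"
    if p: "\<And>s. vague_close \<Phi> (1/2) (dirac_comb ((+) (s + p) ` L)) (dirac_comb ((+) s ` L))" for p
  proof -
    \<comment> \<open>In the translate by \<open>s = -(p + x)\<close>, the point \<open>x\<close> of \<open>L\<close> is moved by \<open>s + p\<close> to the origin, and \<open>x + f\<close> to \<open>f\<close>.\<close>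
    have fwd: "\<exists>m\<in>N. p + x + (f + m) \<in> L" if "x \<in> L" "x + f \<in> L" "f \<in> K" for x f
    proof -
      have "- (p + x) + p = - x" by simp
      with p[of "- (p + x)"]
      have "vague_close \<Phi> (1/2) (dirac_comb ((+) (- x) ` L)) (dirac_comb ((+) (- (p + x)) ` L))" by simp
      moreover have "f \<in> (+) (- x) ` L \<inter> K" using that by (simp only: Int_iff shift simp_thms)
      ultimately have "\<exists>m\<in>N. f + m \<in> (+) (- (p + x)) ` L"
        by (intro \<Phi>(3)[OF locally_finite_translate[OF L] locally_finite_translate[OF L]])
      then show ?thesis by (simp only: shift)
    qed
    \<comment> \<open>The same with the two translates interchanged, at the origin only.\<close>
    have bwd: "\<exists>m\<in>N. y - p + m \<in> L" if "y \<in> L" for y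
    proof -
      have "- y + p = - (y - p)" by simp
      with p[of "- y"]
      have "vague_close \<Phi> (1/2) (dirac_comb ((+) (- y) ` L)) (dirac_comb ((+) (- (y - p)) ` L))"
        unfolding vague_close_def by (simp only: dist_commute)
      moreover have "0 \<in> (+) (- y) ` L \<inter> K" using that by (simp add: shift[of 0 y, simplified] K_def)
      ultimately have "\<exists>m\<in>N. 0 + m \<in> (+) (- (y - p)) ` L"
        by (intro \<Phi>(3)[OF locally_finite_translate[OF L] locally_finite_translate[OF L]])
      then show ?thesis by (simp only: shift add_0_left)
    qed
    have "0 \<in> K" by (simp add: K_def)
    obtain x0 where x0: "x0 \<in> L" using K'(2) by blast
    obtain n where n: "n \<in> N" "p + x0 + n \<in> L" using fwd[OF x0, of 0] x0 \<open>0 \<in> K\<close> by auto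
    have all: "p + y + n \<in> L" if "y \<in> L" for y
    proof (rule relatively_dense_chain_induct[OF W(3) K'(2), of "\<lambda>y. p + y + n \<in> L"])
      fix x y w k k' assume x: "x \<in> L" "y \<in> L" "p + x + n \<in> L" and w: "w \<in> insert 0 W" and k: "k \<in> K'" "k' \<in> K'"
        and yx: "y - x = k - k' + w \<or> y - x = k - k' - w"
      have "y - x = k - k' - (- w) \<or> y - x = k - k' - w" using yx by simp
      moreover have "w \<in> W'" "- w \<in> W'" using w by (auto simp: W'_def)
      ultimately have yxK: "y - x \<in> K" using k unfolding K_def by blast
      obtain m where m: "m \<in> N" "p + x + (y - x + m) \<in> L" using fwd[OF x(1) _ yxK] x(2) by auto
      have "y - x \<in> differences L" using x by (auto simp: differences_def)
      moreover have "(p + x + (y - x + m)) - (p + x + n) \<in> differences L"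
        using m(2) x(3) unfolding differences_def by blast
      then have "y - x + (m - n) \<in> differences L" by (simp add: algebra_simps)
      ultimately have "m - n = 0" using isolated[OF _ yxK] N1[OF m(1) n(1)] by blast
      with m(2) show "p + y + n \<in> L" by (simp add: algebra_simps)
    qed (use x0 n(2) that in auto)
    have "(+) (p + n) ` L = L"
    proof
      show "(+) (p + n) ` L \<subseteq> L" using all by (auto simp: ac_simps)
      show "L \<subseteq> (+) (p + n) ` L"
      proof
        fix y assume y: "y \<in> L"
        obtain m where m: "m \<in> N" "y - p + m \<in> L" using bwd[OF y] by blast
        \<comment> \<open>The point \<open>y - p + m\<close> of \<open>L\<close> is moved by \<open>p + n\<close> to a point of \<open>L\<close> close to \<open>y\<close>, hence to \<open>y\<close>.\<close>
        have "p + (y - p + m) + n \<in> L" using all[OF m(2)] .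
        then have "(p + (y - p + m) + n) - y \<in> differences L" "y - y \<in> differences L"
          using y unfolding differences_def by blast+
        then have "0 + (n - (- m)) \<in> differences L" "0 \<in> differences L" by (simp_all add: algebra_simps)
        moreover have "n - (- m) \<in> N1" using m(1) n(1) N2(3)[of n "- m"] by (simp add: N_def)
        ultimately have "n - (- m) = 0" using isolated \<open>0 \<in> K\<close> by blast
        then have "y = (p + n) + (y - p + m)" by (simp add: algebra_simps)
        then show "y \<in> (+) (p + n) ` L" using m(2) by (rule image_eqI)
      qed
    qed
    then have "p + n \<in> periods L" by (simp add: periods_def)
    then show ?thesis using n(1) Q(4) by (auto simp: N_def)
  qed
  with \<Phi>(1,2) Q(2) show ?thesis using that by blast
qed

section \<open>Equicontinuous hulls come from completely periodic sets\<close>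

text \<open>The hull is totally bounded, so every \<open>t\<close> has \<open>t + L\<close> close to \<open>r + L\<close> for one of finitely many \<open>r\<close>.
Equicontinuity keeps this closeness under all translations, which makes \<open>t - r\<close> a uniform almost
period. It differs from a period by an element of a compact set.\<close>

lemma equicontinuous_imp_completely_periodic:
  fixes L :: "'a::{topological_ab_group_add, t2_space} set"
  assumes lc: "locally_compact_space (euclidean :: 'a topology)"
    and cg: "compactly_generated TYPE('a)"
    and L: "locally_finite L" and dense: "relatively_dense L"
    and D: "locally_finite (differences L)"
    and eq: "equicontinuous_system (hull_space L) translate_measure"
  shows "completely_periodic L"
proof -
  let ?X = "topspace (hull_space L)"
  define \<pi> where "\<pi> = (\<lambda>t. dirac_comb ((+) t ` L))"
  have tr: "translate_measure s (\<pi> t) = \<pi> (s + t)" for s t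
    unfolding \<pi>_def by (rule translate_measure_orbit)
  have orbit: "range \<pi> \<subseteq> ?X" using orbit_in_hull[OF L] by (auto simp: \<pi>_def)
  have cpt: "compact_space (hull_space L)" by (rule compact_hull_space[OF lc D dense])
  have comp: "compatible_uniformity (hull_space L) (vague_uniformity ?X)"
    by (rule compatible_uniformity_hull[OF L])
  have U: "uniformity_of (hull_space L) = vague_uniformity ?X"
    by (rule uniformity_of_eqI[OF cpt comp])
  obtain \<Phi> :: "('a \<Rightarrow> complex) set" and Q where \<Phi>: "finite \<Phi>" "\<Phi> \<subseteq> Cc" and Q: "compact Q"
    and test: "\<And>p. (\<And>s. vague_close \<Phi> (1/2) (\<pi> (s + p)) (\<pi> s)) \<Longrightarrow> \<exists>n\<in>Q. p + n \<in> periods L"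
    unfolding \<pi>_def using exists_almost_period_test[OF lc cg L dense D] by metis
  have "eventually (\<lambda>(x, y). vague_close \<Phi> (1/2) x y) (vague_uniformity ?X)"
    unfolding eventually_vague_uniformity using \<Phi> by (intro exI[of _ \<Phi>] exI[of _ "1/2"]) simp
  then obtain E where E: "eventually E (vague_uniformity ?X)"
    "\<And>x y s. E (x, y) \<Longrightarrow> vague_close \<Phi> (1/2) (translate_measure s x) (translate_measure s y)"
    using eq unfolding equicontinuous_system_def U by fastforce
  obtain F where F: "finite F" "F \<subseteq> range \<pi>" "\<And>x. x \<in> range \<pi> \<Longrightarrow> \<exists>y\<in>F. E (x, y)"
    using compatible_uniformity_totally_bounded[OF cpt comp E(1) orbit] by blast
  obtain T where T: "finite T" "F = \<pi> ` T"
    using finite_subset_image[OF F(1,2)] by blast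
  define K where "K = {r - n |r n. r \<in> T \<and> n \<in> Q}"
  have "compact K" unfolding K_def by (rule compact_differences[OF finite_imp_compact[OF T(1)] Q])
  moreover have "t \<in> {a + k |a k. a \<in> periods L \<and> k \<in> K}" for t
  proof -
    obtain r where r: "r \<in> T" "E (\<pi> t, \<pi> r)" using F(3)[of "\<pi> t"] T(2) by blast
    have "vague_close \<Phi> (1/2) (\<pi> (s + (t - r))) (\<pi> s)" for s
      using E(2)[OF r(2), of "s - r"] by (simp add: tr algebra_simps)
    then obtain n where n: "n \<in> Q" "t - r + n \<in> periods L" using test by blast
    moreover have "t = (t - r + n) + (r - n)" by simp
    ultimately show ?thesis using r(1) unfolding K_def by blast
  qed
  ultimately show ?thesis unfolding completely_periodic_def relatively_dense_def by blast
qed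

theorem theorem5p5:
  fixes L :: "'a::{topological_ab_group_add, t2_space} set"
  assumes "locally_compact_space (euclidean :: 'a topology)"
    and "compactly_generated TYPE('a)"
    and "delone_set L"
    and "finite_local_complexity L"
  shows "completely_periodic L \<longleftrightarrow> equicontinuous_system (hull_space L) translate_measure"
proof -
  have L: "locally_finite L" and dense: "relatively_dense L"
    using assms(3) uniformly_discrete_imp_locally_finite by (auto simp: delone_set_def)
  have D: "locally_finite (differences L)"
    using L assms(4) by (rule differences_locally_finite)
  show ?thesis
    using completely_periodic_imp_equicontinuous[OF assms(1) L]
      equicontinuous_imp_completely_periodic[OF assms(1,2) L dense D] by blast
qed

end
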